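(* For every $N \in \mathbb{N}\setminus\{0,1\}$, $s\in(0,1)$ and $p\in[1,\infty)$ satisfying $sp>1$, there exists a constant $C\in(0,\infty)$ such that every $u \in \dot W^{s,p}(\mathbb{R}^N_+)$ has a trace $v=\operatorname{tr}_{\partial\mathbb{R}^N_+}u$ satisfying $$\int_{\partial\mathbb{R}^N_+}\Bigl(\int_{\mathbb{R}^N_+}\frac{|v(x)-u(y)|^p}{|x-y|^{N-1+sp}}\,\mathrm{d}y\Bigr)\mathrm{d}x \le C \iint_{\mathbb{R}^N_+\times\mathbb{R}^N_+}\frac{|u(y)-u(z)|^p}{|y-z|^{N+sp}}\,\mathrm{d}y\,\mathrm{d}z .$$
   Context: $\mathbb{R}^N_+ = \mathbb{R}^{N-1}\times(0,\infty)$. Its boundary $\partial\mathbb{R}^N_+ = \mathbb{R}^{N-1}\times\{0\}$ is identified with $\mathbb{R}^{N-1}$ and carries the $(N-1)$-dimensional Lebesgue measure; $|x-y|$ is the Euclidean distance in $\mathbb{R}^N$. The homogeneous fractional Sobolev space $\dot W^{s,p}(\mathbb{R}^N_+)$ is the set of measurable functions $u\colon\mathbb{R}^N_+\to\mathbb{R}$ such that $\iint_{\mathbb{R}^N_+\times\mathbb{R}^N_+}\frac{|u(y)-u(z)|^p}{|y-z|^{N+sp}}\,\mathrm{d}y\,\mathrm{d}z<\infty$. The trace $\operatorname{tr}_{\partial\mathbb{R}^N_+}u$ (defined since $sp>1$) is the usual trace, i.e. the continuous extension of the restriction $u\mapsto u|_{\partial\mathbb{R}^N_+}$ from functions that are $C^1$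 up to the boundary; equivalently, it is the limit in $L^1_{\mathrm{loc}}(\mathbb{R}^{N-1})$ of $u(\cdot,t)$ as $t\to0^+$ (for a suitable representative of $u$). *)

theory Defs
  imports "HOL-Analysis.Analysis"
begin

text \<open>
  With \<open>N - 1 = CARD('n)\<close>, the space \<open>\<real>\<^sup>N\<close> is the product type
  \<^typ>\<open>(real ^ 'n) \<times> real\<close>, which carries the Euclidean norm and has dimension \<open>N\<close>;
  since \<^prop>\<open>CARD('n::finite) \<ge> 1\<close>, exactly the dimensions \<open>N \<ge> 2\<close> occur.
\<close>

definition half_space :: "((real ^ 'n) \<times> real) set" where
  "half_space = UNIV \<times> {0<..}"

text \<open>
  The \<open>p\<close>-th power of the Gagliardo seminorm, in \<open>[0, \<infinity>]\<close>. On the diagonal, a null set for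
  the measure, the integrand is \<open>0 / 0 = 0\<close>.
\<close>

definition gagliardo ::
    "real \<Rightarrow> real \<Rightarrow> 'a::euclidean_space set \<Rightarrow> ('a \<Rightarrow> real) \<Rightarrow> ennreal" where
  "gagliardo s p A u =
     (\<integral>\<^sup>+ (y, z). ennreal (\<bar>u y - u z\<bar> powr p / norm (y - z) powr (real DIM('a) + s * p))
        \<partial>lebesgue_on (A \<times> A))"

text \<open>
  Functions are total; the values outside \<open>A\<close> play no role.
\<close>

definition hom_sobolev ::
    "real \<Rightarrow> real \<Rightarrow> 'a::euclidean_space set \<Rightarrow> ('a \<Rightarrow> real) set" where
  "hom_sobolev s p A = {u \<in> borel_measurable (lebesgue_on A). gagliardo s p A u < \<infinity>}"

definition locally_integrable :: "('a::euclidean_space \<Rightarrow> real) \<Rightarrow> bool" where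
  "locally_integrable f \<longleftrightarrow> (\<forall>K. compact K \<longrightarrow> f absolutely_integrable_on K)"

text \<open>
  \<open>v\<close> is the limit in \<open>L\<^sup>1\<^sub>l\<^sub>o\<^sub>c\<close> of the slices \<open>w(\<cdot>, t)\<close> as \<open>t \<rightarrow> 0+\<close>, for some
  representative \<open>w\<close> of \<open>u\<close>. By Fubini, the slices of two representatives agree almost
  everywhere for almost every \<open>t\<close>; since the limit runs through all \<open>t > 0\<close>, this determines
  \<open>v\<close> up to a null set, independently of \<open>w\<close>.
\<close>

definition has_trace :: "((real ^ 'n) \<times> real \<Rightarrow> real) \<Rightarrow> (real ^ 'n \<Rightarrow> real) \<Rightarrow> bool" where
  "has_trace u v \<longleftrightarrow>
     locally_integrable v \<and>
     (\<exists>w. (AE y in lebesgue_on half_space. w y = u y) \<and>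
          (\<forall>t>0. locally_integrable (\<lambda>x. w (x, t))) \<and>
          (\<forall>K. compact K \<longrightarrow>
             ((\<lambda>t. LINT x:K|lebesgue. \<bar>w (x, t) - v x\<bar>) \<longlongrightarrow> 0) (at_right 0)))"

end

theory Submission imports Defs begin

text \<open>
  Write \<open>d = N - 1\<close> and let \<open>Q(y, r)\<close> be the cylinder of radius and height \<open>r\<close> standing on \<open>y\<close>, which
  lies in the half space as soon as \<open>y\<close> lies in its closure. Two quantities carry the proof: the
  average \<open>avg r y\<close> of \<open>u\<close> over \<open>Q(y, r)\<close>, and the oscillation \<open>osc y r\<close>, the mean of
  \<open>|u(a) - u(b)|\<^sup>p\<close> over \<open>a, b \<in> Q(y, r)\<close>. By Jensen's inequality, two averages over comparable nested
  cylinders differ in \<open>p\<close>-th power by at most a constant times the oscillation over the larger one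
  (\<open>average_diff_le\<close>).

  Integrating \<open>osc (x, t) r\<close> over \<open>x\<close> at a fixed height \<open>t\<close> counts each pair \<open>(a, b)\<close> at distance
  \<open>\<lesssim> r\<close> with weight \<open>\<sim> r\<^bsup>d - 2(d + 1)\<^esup>\<close>, hence is at most \<open>C r\<^bsup>sp - 1\<^esup>\<close> times the Gagliardo energy.
  This is where \<open>sp > 1\<close> enters: the bound is summable over \<open>r = 2\<^sup>-\<^sup>k\<close>, even with weights
  \<open>2\<^bsup>k \<epsilon>\<^esup>\<close>, \<open>\<epsilon> = (sp - 1)/2\<close>. So the dyadic averages at almost every boundary point converge; their
  limit is the trace \<open>v\<close>, and \<open>|avg r (x, 0) - v(x)|\<^sup>p\<close> is controlled by a weighted series of
  oscillations at the scales \<open>r 2\<^sup>-\<^sup>k\<close> (\<open>osc_series_telescope\<close>). These weights replace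
  Minkowski's inequality.

  For the inequality, compare \<open>u(y)\<close> with \<open>v(x)\<close> through the average \<open>avg r (x, 0)\<close> at the dyadic scale
  \<open>r \<sim> |y - (x, 0)|\<close>. After an exchange of the order of integration, both parts become integrals of
  \<open>|u(a) - u(b)|\<^sup>p\<close> against a kernel, and the tail bound
  \<open>\<integral> max(|z|, \<rho>)\<^bsup>-(n + \<gamma>)\<^esup> dz \<le> C \<rho>\<^bsup>-\<gamma>\<^esup>\<close> shows that the kernel is at most
  \<open>C |a - b|\<^bsup>-(N + sp)\<^esup>\<close>. The \<open>k\<close>-th scale of the series gains a factor \<open>2\<^bsup>-k(sp - 1)\<^esup>\<close>;
  see \<open>trace_integral_le\<close>.

  That \<open>v\<close> is the trace needs the slices at almost every height \<open>t\<close>, not just their integral over \<open>t\<close>.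
  For almost every \<open>t\<close> the averages standing on height \<open>t\<close> converge almost everywhere to \<open>u(\<cdot>, t)\<close>, at
  the same rate as those standing on the boundary converge to \<open>v\<close>. Comparing both at scale \<open>r \<sim> t\<close>
  gives \<open>\<integral> |u(x, t) - v(x)|\<^sup>p dx \<le> C t\<^bsup>sp - 1\<^esup>\<close> (lemma \<open>slice_distance_le\<close>).
  On the remaining null set of heights, the representative is given the value \<open>v\<close>.
\<close>

section \<open>Inequalities for powers, averages and telescoping sums\<close>

lemma ennreal_mult_fold: "a \<ge> 0 \<Longrightarrow> ennreal a * (ennreal b * x) = ennreal (a * b) * x"
  by (simp add: ennreal_mult' mult.assoc)

text \<open>
  The graph of the convex function \<open>x \<mapsto> x\<^sup>p\<close> lies above its tangents, the boundary point \<open>0\<close> included.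
\<close>

lemma powr_ge_tangent:
  fixes a b p :: real
  assumes "a \<ge> 0" "b \<ge> 0" "p \<ge> 1"
  shows "a powr p + p * a powr (p - 1) * (b - a) \<le> b powr p"
proof -
  consider "a = 0" | "a > 0" "b = 0" | "a > 0" "b > 0" using assms by fastforce
  then show ?thesis
  proof cases
    case 1 then show ?thesis by simp
  next
    case 2
    have "a powr (p - 1) * a = a powr p" using 2 by (simp add: powr_diff)
    then have "a powr p + p * a powr (p - 1) * (b - a) = (1 - p) * a powr p"
      using 2 by (simp add: algebra_simps)
    also have "\<dots> \<le> 0" using assms by (intro mult_nonpos_nonneg) auto
    also have "0 = b powr p" using 2 by simp
    finally show ?thesis .
  next
    case 3
    have "b powr p - a powr p \<ge> (p * a powr (p - 1)) * (b - a)"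
    proof (rule convex_on_imp_above_tangent[where A = "{0<..}"])
      show "convex_on {0<..} (\<lambda>x. x powr p)" using assms by (intro powr_convex) auto
      show "((\<lambda>x. x powr p) has_real_derivative p * a powr (p - 1)) (at a within {0<..})"
        using 3 by (auto intro!: derivative_eq_intros)
    qed (use 3 in \<open>auto simp: interior_open\<close>)
    then show ?thesis by linarith
  qed
qed

text \<open>
  Jensen's inequality for \<open>x \<mapsto> |x - c|\<^sup>p\<close>: integrate the tangent inequality at the mean \<open>A\<close> of
  \<open>|f - c|\<close>, in which the linear term has integral zero. The right-hand side may be infinite.
\<close>

lemma jensen_average:
  fixes f :: "'a \<Rightarrow> real"
  assumes p: "p \<ge> 1" and Q[measurable]: "Q \<in> sets M" and m: "emeasure M Q = ennreal m" "m > 0"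
    and f[measurable]: "f \<in> borel_measurable M" and int: "set_integrable M Q f"
  shows "ennreal (\<bar>(LINT b:Q|M. f b) / m - c\<bar> powr p)
       \<le> ennreal (1 / m) * (\<integral>\<^sup>+ b. indicator Q b * ennreal (\<bar>f b - c\<bar> powr p) \<partial>M)"
proof (cases "(\<integral>\<^sup>+ b. indicator Q b * ennreal (\<bar>f b - c\<bar> powr p) \<partial>M) = \<infinity>")
  case True
  have "ennreal (1 / m) \<noteq> 0" using m by simp
  then show ?thesis unfolding True by (simp add: ennreal_mult_top)
next
  case False
  define g where "g b = \<bar>f b - c\<bar>" for b
  have [measurable]: "g \<in> borel_measurable M" unfolding g_def by measurable
  have mQ: "measure M Q = m" using m by (simp add: measure_def)
  have cQ: "set_integrable M Q (\<lambda>_. k::real)" for k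
    unfolding set_integrable_def using m by (intro integrable_scaleR_left integrable_real_indicator) auto
  have cI: "(LINT _:Q|M. k) = m * k" for k :: real
    using mQ by (simp add: set_lebesgue_integral_def)
  have gi: "set_integrable M Q g"
    unfolding g_def using set_integral_diff(1)[OF int cQ[of c]] by (rule set_integrable_abs)
  have eq: "ennreal (indicator Q b *\<^sub>R (g b powr p)) = indicator Q b * ennreal (\<bar>f b - c\<bar> powr p)" for b
    by (auto simp: g_def indicator_def)
  have gpi: "set_integrable M Q (\<lambda>b. g b powr p)"
    unfolding set_integrable_def
    by (rule integrableI_nonneg) (use False in \<open>auto simp: eq[unfolded real_scaleR_def] less_top\<close>)
  have nn: "(\<integral>\<^sup>+ b. indicator Q b * ennreal (\<bar>f b - c\<bar> powr p) \<partial>M) = ennreal (LINT b:Q|M. g b powr p)"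
    using gpi unfolding eq[symmetric] set_lebesgue_integral_def set_integrable_def
    by (subst nn_integral_eq_integral) auto
  define A where "A = (LINT b:Q|M. g b) / m"
  have A0: "A \<ge> 0" unfolding A_def using m
    by (intro divide_nonneg_pos) (auto simp: set_lebesgue_integral_def g_def intro!: integral_nonneg_AE)
  have "(LINT b:Q|M. f b) - m * c = (LINT b:Q|M. f b - c)"
    using set_integral_diff(2)[OF int cQ[of c]] mQ by (simp add: set_lebesgue_integral_def)
  moreover have "\<bar>LINT b:Q|M. f b - c\<bar> \<le> (LINT b:Q|M. g b)"
    unfolding g_def set_lebesgue_integral_def
    by (rule order_trans[OF integral_abs_bound]) (simp add: abs_mult)
  ultimately have le: "\<bar>(LINT b:Q|M. f b) / m - c\<bar> \<le> A"
    using m unfolding A_def by (simp add: field_simps abs_if split: if_splits)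
  have "m * A powr p = (LINT b:Q|M. A powr p + p * A powr (p - 1) * (g b - A))"
  proof -
    have "(LINT b:Q|M. A powr p + p * A powr (p - 1) * (g b - A))
        = (LINT b:Q|M. (A powr p - p * A powr (p - 1) * A) + p * A powr (p - 1) * g b)"
      by (simp add: algebra_simps)
    also have "\<dots> = m * (A powr p - p * A powr (p - 1) * A) + p * A powr (p - 1) * (LINT b:Q|M. g b)"
      by (subst set_integral_add(2)[OF cQ set_integrable_mult_right[OF gi]])
        (simp add: cI set_integral_mult_right)
    also have "(LINT b:Q|M. g b) = m * A" using m by (simp add: A_def)
    finally show ?thesis by (simp add: algebra_simps)
  qed
  also have "\<dots> \<le> (LINT b:Q|M. g b powr p)"
  proof (rule set_integral_mono[OF _ gpi])
    show "set_integrable M Q (\<lambda>b. A powr p + p * A powr (p - 1) * (g b - A))"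
      by (intro set_integral_add(1) set_integral_diff(1) set_integrable_mult_right cQ gi)
    show "A powr p + p * A powr (p - 1) * (g b - A) \<le> g b powr p" for b
      by (rule powr_ge_tangent[OF A0 _ p]) (simp add: g_def)
  qed
  finally have "A powr p \<le> (1 / m) * (LINT b:Q|M. g b powr p)" using m by (simp add: field_simps)
  moreover have "\<bar>(LINT b:Q|M. f b) / m - c\<bar> powr p \<le> A powr p"
    using le p by (intro powr_mono2) auto
  ultimately show ?thesis unfolding nn
    using m by (subst ennreal_mult'[symmetric]) (auto intro!: ennreal_leI)
qed

text \<open>
  If \<open>M\<^sup>p\<close> is the weighted sum, then each increment is at most \<open>M q\<^sup>k\<close> with \<open>q = 2\<^bsup>-e/p\<^esup> < 1\<close>, and these
  bounds add up to \<open>M / (1 - q)\<close>. The geometric weight thus lets one pass from \<open>p\<close>-th powers of the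
  increments to the \<open>p\<close>-th power of their sum, at the price of an arbitrarily small power of the scale.
\<close>

lemma telescope_powr:
  fixes f :: "nat \<Rightarrow> real" and e p l :: real
  assumes p: "p > 0" and e: "e > 0"
    and fin: "(\<Sum>k. ennreal (2 powr (k * e)) * ennreal (\<bar>f (Suc k) - f k\<bar> powr p)) < \<infinity>"
  shows "convergent f"
    and "f \<longlonglongrightarrow> l \<Longrightarrow> ennreal (\<bar>f 0 - l\<bar> powr p) \<le> ennreal ((1 - 2 powr (- e / p)) powr - p)
          * (\<Sum>k. ennreal (2 powr (k * e)) * ennreal (\<bar>f (Suc k) - f k\<bar> powr p))"
proof -
  define q where "q = 2 powr (- e / p)"
  have q: "0 < q" "q < 1" using p e by (auto simp: q_def powr_less_one)
  define S where "S = enn2real (\<Sum>k. ennreal (2 powr (k * e)) * ennreal (\<bar>f (Suc k) - f k\<bar> powr p))"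
  have S: "(\<Sum>k. ennreal (2 powr (k * e)) * ennreal (\<bar>f (Suc k) - f k\<bar> powr p)) = ennreal S" and S0: "S \<ge> 0"
    using fin by (auto simp: S_def ennreal_enn2real)
  define M where "M = S powr (1 / p)"
  have bd: "\<bar>f (Suc k) - f k\<bar> \<le> M * q ^ k" for k
  proof -
    have "ennreal (2 powr (k * e)) * ennreal (\<bar>f (Suc k) - f k\<bar> powr p) \<le> ennreal S"
      unfolding S[symmetric]
      using sum_le_suminf[OF summableI, of "{k}" "\<lambda>k. ennreal (2 powr (k * e))
          * ennreal (\<bar>f (Suc k) - f k\<bar> powr p)"]
      by simp
    then have "2 powr (k * e) * \<bar>f (Suc k) - f k\<bar> powr p \<le> S"
      using S0 by (simp add: ennreal_mult'[symmetric])
    then have "\<bar>f (Suc k) - f k\<bar> powr p \<le> S * 2 powr (- (k * e))"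
      by (simp add: powr_minus field_simps)
    then have "(\<bar>f (Suc k) - f k\<bar> powr p) powr (1 / p) \<le> (S * 2 powr (- (k * e))) powr (1 / p)"
      using p by (intro powr_mono2) auto
    moreover have "(2 powr (- (k * e))) powr (1 / p) = q ^ k"
      by (simp add: q_def powr_powr powr_realpow[symmetric] mult.commute)
    ultimately show ?thesis using p S0 by (simp add: powr_powr powr_mult M_def)
  qed
  have sm: "summable (\<lambda>k. f (Suc k) - f k)"
    by (rule summable_comparison_test'[where N = 0 and g = "\<lambda>k. M * q ^ k"])
      (use bd q in \<open>auto intro!: summable_mult summable_geometric\<close>)
  then have "convergent (\<lambda>n. \<Sum>k<n. f (Suc k) - f k)" by (simp add: summable_iff_convergent)
  then have c: "convergent (\<lambda>n. f n - f 0)" by (simp add: sum_lessThan_telescope)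
  then show "convergent f" using convergent_add[OF c convergent_const[of "f 0"]] by simp
  show "ennreal (\<bar>f 0 - l\<bar> powr p) \<le> ennreal ((1 - 2 powr (- e / p)) powr - p)
          * (\<Sum>k. ennreal (2 powr (k * e)) * ennreal (\<bar>f (Suc k) - f k\<bar> powr p))"
    if l: "f \<longlonglongrightarrow> l"
  proof -
  have "(\<Sum>k. f (Suc k) - f k) = l - f 0" using l by (intro sums_unique[symmetric] telescope_sums)
  moreover have "\<bar>\<Sum>k. f (Suc k) - f k\<bar> \<le> (\<Sum>k. M * q ^ k)"
    by (rule order_trans[OF summable_rabs])
      (use bd q in \<open>auto intro!: suminf_le summable_mult summable_geometric
         summable_comparison_test'[where N = 0 and g = "\<lambda>k. M * q ^ k"]\<close>)
  moreover have "(\<Sum>k. M * q ^ k) = M / (1 - q)"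
    using q by (simp add: suminf_mult suminf_geometric summable_geometric)
  ultimately have "\<bar>f 0 - l\<bar> \<le> M / (1 - q)" by (simp add: abs_minus_commute)
  then have "\<bar>f 0 - l\<bar> powr p \<le> (M / (1 - q)) powr p" using p by (intro powr_mono2) auto
  also have "\<dots> = (1 - q) powr - p * S"
    using p q S0 by (simp add: M_def powr_divide powr_powr powr_minus_divide)
  finally show ?thesis
    unfolding S q_def[symmetric] using S0 by (simp add: ennreal_mult'[symmetric] ennreal_leI)
  qed
qed

lemma powr_sum_le:
  fixes a b p :: real
  assumes "a \<ge> 0" "b \<ge> 0" "p \<ge> 0"
  shows "(a + b) powr p \<le> 2 powr p * (a powr p + b powr p)"
proof -
  have "(a + b) powr p \<le> (2 * max a b) powr p" using assms by (intro powr_mono2) auto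
  also have "\<dots> = 2 powr p * max a b powr p" using assms by (simp add: powr_mult)
  also have "\<dots> \<le> 2 powr p * (a powr p + b powr p)"
    by (intro mult_left_mono) (auto simp: max_def)
  finally show ?thesis .
qed

lemma ennreal_abs_triangle_powr:
  fixes a b c p :: real
  assumes "p \<ge> 0"
  shows "ennreal (\<bar>a - c\<bar> powr p) \<le> ennreal (2 powr p) * (ennreal (\<bar>a - b\<bar> powr p) + ennreal (\<bar>b - c\<bar> powr p))"
proof -
  have "\<bar>a - c\<bar> powr p \<le> (\<bar>a - b\<bar> + \<bar>b - c\<bar>) powr p" using assms by (intro powr_mono2) auto
  also have "\<dots> \<le> 2 powr p * (\<bar>a - b\<bar> powr p + \<bar>b - c\<bar> powr p)" using assms by (intro powr_sum_le) auto
  finally show ?thesis by (simp add: ennreal_mult'[symmetric] ennreal_leI flip: ennreal_plus)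
qed

lemma suminf_geometric_weight:
  fixes e :: real
  assumes "e > 0" "C \<ge> 0"
  shows "(\<Sum>k. ennreal (C * 2 powr - (real k * e))) = ennreal (C / (1 - 2 powr - e))"
proof -
  have q: "2 powr - e < (1::real)" using assms by (simp add: powr_less_one)
  have eq: "2 powr - (real k * e) = (2 powr - e) ^ k" for k
    by (simp add: powr_realpow[symmetric] powr_powr mult.commute)
  have "(\<Sum>k. ennreal (C * (2 powr - e) ^ k)) = ennreal (\<Sum>k. C * (2 powr - e) ^ k)"
    using assms q by (intro suminf_ennreal2) (auto intro!: summable_mult summable_geometric)
  also have "(\<Sum>k. C * (2 powr - e) ^ k) = C / (1 - 2 powr - e)"
    using q by (subst suminf_mult) (auto simp: suminf_geometric intro!: summable_geometric)
  finally show ?thesis by (simp add: eq)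
qed

section \<open>Lebesgue integrals on Euclidean spaces and products\<close>

lemma nn_integral_lborel_translate:
  fixes f :: "'b::euclidean_space \<Rightarrow> ennreal"
  assumes [measurable]: "f \<in> borel_measurable borel"
  shows "(\<integral>\<^sup>+ x. f (a + x) \<partial>lborel) = (\<integral>\<^sup>+ x. f x \<partial>lborel)"
  by (subst (2) lborel_distr_plus[of a, symmetric]) (simp add: nn_integral_distr)

text \<open>
  Decompose dyadically: where \<open>max |z - c| r\<close> lies between \<open>2\<^sup>i r\<close> and \<open>2\<^bsup>i+1\<^esup> r\<close>, the integrand is at most
  \<open>(2\<^sup>i r)\<^bsup>-(n + g)\<^esup>\<close>, and that region lies in a ball of volume \<open>\<sim> (2\<^sup>i r)\<^sup>n\<close>. The sum is geometric of
  ratio \<open>2\<^sup>-\<^sup>g\<close>.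
\<close>

lemma nn_integral_tail:
  fixes r g :: real
  assumes r: "r > 0" and g: "g > 0"
  shows "(\<integral>\<^sup>+ z. ennreal (max (norm (z - c)) r powr - (real DIM('b) + g)) \<partial>(lborel :: 'b::euclidean_space measure))
     \<le> ennreal (unit_ball_vol DIM('b) * 2 ^ DIM('b) / (1 - 2 powr - g) * r powr - g)"
proof -
  let ?n = "DIM('b)" and ?V = "unit_ball_vol DIM('b)"
  define f where "f i z = ennreal ((2 ^ i * r) powr - (real ?n + g)) * indicator (cball c (2 ^ Suc i * r)) z"
    for i and z :: 'b
  have "ennreal (max (norm (z - c)) r powr - (real ?n + g)) \<le> (\<Sum>i. f i z)" for z
  proof -
    define m where "m = max (norm (z - c)) r"
    have m: "m \<ge> r" by (simp add: m_def)
    define i where "i = nat \<lfloor>log 2 (m / r)\<rfloor>"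
    have l0: "log 2 (m / r) \<ge> 0" using m r by simp
    have "2 powr real i \<le> m / r"
      using l0 m r unfolding i_def by (subst powr_le_iff) auto
    then have i1: "2 ^ i * r \<le> m" using r by (simp add: powr_realpow field_simps)
    have "m / r \<le> 2 powr real (Suc i)"
      using l0 m r unfolding i_def by (subst le_powr_iff) (auto, linarith)
    then have i2: "m \<le> 2 ^ Suc i * r" using r by (simp only: powr_realpow[of 2] field_simps)
    have "ennreal (m powr - (real ?n + g)) \<le> f i z"
    proof -
      have "z \<in> cball c (2 ^ Suc i * r)" using i2 by (simp add: m_def dist_norm norm_minus_commute)
      moreover have "m powr - (real ?n + g) \<le> (2 ^ i * r) powr - (real ?n + g)"
        using i1 r g by (intro powr_mono2') auto
      ultimately show ?thesis by (simp add: f_def ennreal_leI)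
    qed
    also have "\<dots> \<le> (\<Sum>i. f i z)" using sum_le_suminf[OF summableI, of "{i}" "\<lambda>i. f i z"] by simp
    finally show ?thesis by (simp add: m_def)
  qed
  then have "(\<integral>\<^sup>+ z. ennreal (max (norm (z - c)) r powr - (real ?n + g)) \<partial>lborel) \<le> (\<integral>\<^sup>+ z. (\<Sum>i. f i z) \<partial>lborel)"
    by (intro nn_integral_mono)
  also have "\<dots> = (\<Sum>i. \<integral>\<^sup>+ z. f i z \<partial>lborel)"
    by (rule nn_integral_suminf) (simp add: f_def[abs_def] borel_measurable_times_ennreal borel_measurable_indicator del: power_Suc)
  also have "(\<lambda>i. \<integral>\<^sup>+ z. f i z \<partial>lborel) = (\<lambda>i. ennreal (?V * 2 ^ ?n * r powr - g * (2 powr - g) ^ i))"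
  proof
    fix i
    have "(\<integral>\<^sup>+ z. f i z \<partial>lborel) = ennreal ((2 ^ i * r) powr - (real ?n + g)) * ennreal (?V * (2 ^ Suc i * r) ^ ?n)"
      unfolding f_def using r by (simp add: nn_integral_cmult_indicator emeasure_cball)
    also have "\<dots> = ennreal ((2 ^ i * r) powr - (real ?n + g) * (?V * (2 ^ Suc i * r) ^ ?n))"
      by (rule ennreal_mult'[symmetric]) simp
    also have "(2 ^ i * r) powr - (real ?n + g) * (?V * (2 ^ Suc i * r) ^ ?n)
        = ?V * 2 ^ ?n * ((2 ^ i * r) powr - (real ?n + g) * (2 ^ i * r) ^ ?n)"
      by (simp only: power_mult_distrib power_Suc ac_simps)
    also have "(2 ^ i * r) powr - (real ?n + g) * (2 ^ i * r) ^ ?n = (2 ^ i * r) powr - g"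
    proof -
      have "(2 ^ i * r) powr - (real ?n + g) * (2 ^ i * r) powr real ?n = (2 ^ i * r) powr - g"
        by (simp add: powr_add[symmetric])
      then show ?thesis using r by (simp add: powr_realpow)
    qed
    also have "\<dots> = r powr - g * (2 powr - g) ^ i"
      using r by (simp add: powr_mult powr_realpow[symmetric] powr_powr mult.commute)
    finally show "(\<integral>\<^sup>+ z. f i z \<partial>lborel) = ennreal (?V * 2 ^ ?n * r powr - g * (2 powr - g) ^ i)"
      by (simp add: mult.assoc)
  qed
  also have "(\<Sum>i. ennreal (?V * 2 ^ ?n * r powr - g * (2 powr - g) ^ i))
      = ennreal (\<Sum>i. ?V * 2 ^ ?n * r powr - g * (2 powr - g) ^ i)"
    using g by (intro suminf_ennreal2) (auto intro!: summable_mult summable_geometric simp: powr_less_one)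
  also have "(\<Sum>i. ?V * 2 ^ ?n * r powr - g * (2 powr - g) ^ i) = ?V * 2 ^ ?n / (1 - 2 powr - g) * r powr - g"
    using g by (subst suminf_mult) (auto simp: suminf_geometric powr_less_one intro!: summable_geometric)
  finally show ?thesis .
qed

lemma borel_measurable_fst_snd [measurable (raw)]:
  fixes f :: "'c \<Rightarrow> 'a::second_countable_topology \<times> 'b::second_countable_topology"
  assumes f: "f \<in> M \<rightarrow>\<^sub>M borel"
  shows "(\<lambda>w. fst (f w)) \<in> M \<rightarrow>\<^sub>M borel" "(\<lambda>w. snd (f w)) \<in> M \<rightarrow>\<^sub>M borel"
  using f by (auto intro!: measurable_compose[OF f] borel_measurable_continuous_onI continuous_intros)

lemma nn_integral_lborel_pair:
  fixes f :: "'a::euclidean_space \<times> 'b::euclidean_space \<Rightarrow> ennreal"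
  assumes [measurable]: "f \<in> borel_measurable borel"
  shows "(\<integral>\<^sup>+ c. f c \<partial>lborel) = (\<integral>\<^sup>+ a. \<integral>\<^sup>+ b. f (a, b) \<partial>lborel \<partial>lborel)"
  unfolding lborel_prod[symmetric]
  by (rule lborel.nn_integral_fst[symmetric]) (simp add: lborel_prod)

lemma nn_integral_lborel_swap:
  fixes f :: "'a::euclidean_space \<Rightarrow> 'b::euclidean_space \<Rightarrow> ennreal"
  assumes [measurable]: "(\<lambda>c. f (fst c) (snd c)) \<in> borel_measurable borel"
  shows "(\<integral>\<^sup>+ a. \<integral>\<^sup>+ b. f a b \<partial>lborel \<partial>lborel) = (\<integral>\<^sup>+ b. \<integral>\<^sup>+ a. f a b \<partial>lborel \<partial>lborel)"
  by (rule lborel_pair.Fubini'[symmetric]) (simp add: lborel_prod split_beta')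

section \<open>Cylinders standing on a point\<close>

text \<open>
  The base at height \<open>snd y\<close> is left out, so that a cylinder standing on a boundary point of the half
  space is contained in the open half space.
\<close>

definition cyl :: "'a::euclidean_space \<times> real \<Rightarrow> real \<Rightarrow> ('a \<times> real) set" where
  "cyl y r = cball (fst y) r \<times> {snd y<..snd y + r}"

lemma in_cyl: "b \<in> cyl y r \<longleftrightarrow> norm (fst b - fst y) \<le> r \<and> snd y < snd b \<and> snd b \<le> snd y + r"
  by (cases b) (auto simp: cyl_def dist_norm norm_minus_commute)

lemma sets_cyl [measurable]: "cyl y r \<in> sets borel"
  unfolding cyl_def borel_prod[symmetric] by (intro pair_measureI) auto

lemma indicator_cyl_measurable [measurable (raw)]:
  assumes [measurable]: "f \<in> M \<rightarrow>\<^sub>M borel" "g \<in> borel_measurable M" "h \<in> M \<rightarrow>\<^sub>M borel"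
  shows "(\<lambda>w. indicator (cyl (f w) (g w)) (h w) :: ennreal) \<in> borel_measurable M"
proof -
  have "(\<lambda>w. indicator (cyl (f w) (g w)) (h w) :: ennreal) = (\<lambda>w. if norm (fst (h w) - fst (f w)) \<le> g w
     \<and> snd (f w) < snd (h w) \<and> snd (h w) \<le> snd (f w) + g w then 1 else 0)"
    by (auto simp: in_cyl indicator_def fun_eq_iff)
  also have "\<dots> \<in> borel_measurable M" by measurable
  finally show ?thesis .
qed

lemma emeasure_cyl:
  "r \<ge> 0 \<Longrightarrow> emeasure lborel (cyl (y :: 'a::euclidean_space \<times> real) r) 
    = ennreal (unit_ball_vol DIM('a) * r ^ Suc DIM('a))"
  unfolding cyl_def lborel_prod[symmetric]
  by (subst lborel.emeasure_pair_measure_Times)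
     (auto simp: emeasure_cball ennreal_mult'[symmetric] algebra_simps)

lemma cyl_diam:
  assumes "a \<in> cyl y r" "b \<in> cyl y r"
  shows "norm (a - b) \<le> 3 * r"
proof -
  have "norm (a - b) \<le> norm (fst a - fst b) + norm (snd a - snd b)"
    by (metis fst_diff norm_Pair_le prod.collapse snd_diff)
  moreover have "norm (fst a - fst b) \<le> 2 * r"
    using norm_triangle_sub[of "fst a - fst y" "fst b - fst y"] norm_triangle_ineq4[of "fst a - fst y" "fst b - fst y"] assms
    by (auto simp: in_cyl)
  moreover have "norm (snd a - snd b) \<le> r" using assms by (auto simp: in_cyl)
  ultimately show ?thesis by linarith
qed

section \<open>Averages and oscillations\<close>

text \<open>
  The parameters \<open>V\<close>, \<open>\<alpha>\<close> and \<open>vol\<close> abbreviate terms in the dimension of the boundary: \<open>\<alpha> = N + sp\<close> is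
  the exponent of the Gagliardo kernel and \<open>vol r\<close> the volume of a cylinder of size \<open>r\<close>. Defined as
  constants, they would take the type of the boundary as an additional argument. The function \<open>u\<close> is
  Borel on the whole space, so that Fubini's theorem for Borel measures applies; a Lebesgue measurable
  function agrees with such a function up to a null set.
\<close>

locale sobolev_fun =
  fixes u :: "'a::euclidean_space \<times> real \<Rightarrow> real" and s p :: real
    and V \<alpha> :: real and vol :: "real \<Rightarrow> real"
  assumes V_def: "V = unit_ball_vol DIM('a)"
    and \<alpha>_def: "\<alpha> = real DIM('a) + 1 + s * p"
    and vol_def: "\<And>r. vol r = V * r ^ Suc DIM('a)"
    and u_meas [measurable]: "u \<in> borel_measurable borel"
    and p_ge: "1 \<le> p" and sp: "s * p > 1"
    and fin: "gagliardo s p (UNIV \<times> {0<..}) u < \<infinity>"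
begin

abbreviation H :: "('a \<times> real) set" where "H \<equiv> UNIV \<times> {0<..}"

lemma V_pos: "V > 0" by (simp add: V_def)

lemma vol_pos: "r > 0 \<Longrightarrow> vol r > 0"
  using V_pos by (simp add: vol_def)

lemma emeasure_cyl_vol: "r > 0 \<Longrightarrow> emeasure lborel (cyl (y :: 'a \<times> real) r) = ennreal (vol r)"
  by (simp add: emeasure_cyl vol_def V_def del: power_Suc)

definition energy :: ennreal where "energy = gagliardo s p H u"

definition diff_pow :: "('a \<times> real) \<times> ('a \<times> real) \<Rightarrow> ennreal" where
  "diff_pow c = indicator (H \<times> H) c * ennreal (\<bar>u (fst c) - u (snd c)\<bar> powr p)"

lemma H_sets [measurable]: "H \<in> sets borel" "H \<times> H \<in> sets borel"
proof -
  show "H \<in> sets borel" unfolding borel_prod[symmetric] by (intro pair_measureI) auto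
  then show "H \<times> H \<in> sets borel" unfolding borel_prod[symmetric, where 'a = "'a \<times> real"]
      by (intro pair_measureI) auto
qed

lemma diff_pow_measurable [measurable]: "diff_pow \<in> borel_measurable borel"
  unfolding diff_pow_def by measurable

lemma \<alpha>_pos: "\<alpha> > 0" using sp by (simp add: \<alpha>_def)

lemma energy_eq: "energy = (\<integral>\<^sup>+ c. diff_pow c * ennreal (norm (fst c - snd c) powr - \<alpha>) \<partial>lborel)"
proof -
  have "energy = (\<integral>\<^sup>+ c. (case c of (y, z) \<Rightarrow>
      ennreal (\<bar>u y - u z\<bar> powr p / norm (y - z) powr (real DIM('a \<times> real) + s * p)))
          * indicator (H \<times> H) c \<partial>lebesgue)"
    unfolding energy_def gagliardo_def by (rule nn_integral_restrict_space) (simp add: H_sets)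
  also have "real DIM('a \<times> real) + s * p = \<alpha>" by (simp add: \<alpha>_def)
  also have "(\<integral>\<^sup>+ c. (case c of (y, z) \<Rightarrow> ennreal (\<bar>u y - u z\<bar> powr p / norm (y - z) powr \<alpha>))
      * indicator (H \<times> H) c \<partial>lebesgue)
      = (\<integral>\<^sup>+ c. diff_pow c * ennreal (norm (fst c - snd c) powr - \<alpha>) \<partial>lborel)"
    unfolding nn_integral_completion
    by (intro nn_integral_cong)
      (auto simp: diff_pow_def powr_minus_divide ennreal_mult'[symmetric] indicator_def add_ac split: prod.splits)
  finally show ?thesis .
qed

lemma energy_fin: "energy < \<infinity>" using fin by (simp add: energy_def)

text \<open>
  All estimates below by the energy have this form: after exchanging integrals, \<open>|u(a) - u(b)|\<^sup>p\<close> is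
  integrated against a kernel that is compared pointwise with the Gagliardo kernel. The diagonal may be
  left out, because the difference vanishes there.
\<close>

lemma kernel_le:
  assumes C: "C \<ge> 0"
    and k: "\<And>a b. a \<in> H \<Longrightarrow> b \<in> H \<Longrightarrow> a \<noteq> b \<Longrightarrow> k (a, b) \<le> ennreal (C * norm (a - b) powr - \<alpha>)"
  shows "(\<integral>\<^sup>+ c. k c * diff_pow c \<partial>lborel) \<le> ennreal C * energy"
proof -
  have "k c * diff_pow c \<le> ennreal C * (diff_pow c * ennreal (norm (fst c - snd c) powr - \<alpha>))" for c
  proof (cases "c \<in> H \<times> H \<and> fst c \<noteq> snd c")
    case True
    then have "k c \<le> ennreal C * ennreal (norm (fst c - snd c) powr - \<alpha>)"
      using k[of "fst c" "snd c"] C by (cases c) (auto simp: ennreal_mult')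
    from mult_right_mono[OF this, of "diff_pow c"] show ?thesis by (simp add: ac_simps)
  next
    case False then have "diff_pow c = 0" by (auto simp: diff_pow_def indicator_def)
    then show ?thesis by simp
  qed
  then have "(\<integral>\<^sup>+ c. k c * diff_pow c \<partial>lborel)
      \<le> (\<integral>\<^sup>+ c. ennreal C * (diff_pow c * ennreal (norm (fst c - snd c) powr - \<alpha>)) \<partial>lborel)"
    by (intro nn_integral_mono)
  also have "\<dots> = ennreal C * energy" unfolding energy_eq by (intro nn_integral_cmult) measurable
  finally show ?thesis .
qed

lemma one_le_kernel:
  assumes "a \<noteq> b" "norm (a - b) \<le> 3 * r"
  shows "1 \<le> ennreal ((3 * r) powr \<alpha> * norm (a - b) powr - \<alpha>)"
  using powr_mono2[OF less_imp_le[OF \<alpha>_pos] _ assms(2)] assms(1)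
  by (simp add: powr_minus field_simps)

definition osc :: "'a \<times> real \<Rightarrow> real \<Rightarrow> ennreal" where
  "osc y r = ennreal (1 / (vol r)\<^sup>2)
    * (\<integral>\<^sup>+ c. indicator (cyl y r) (fst c) * indicator (cyl y r) (snd c) * diff_pow c \<partial>lborel)"

text \<open>
  The normalisation is \<open>V r\<^sup>d / (vol r)\<^sup>2\<close>: the volume of a ball of base points over the square of the
  volume of a cylinder.
\<close>

definition near_energy :: "real \<Rightarrow> ennreal" where
  "near_energy r = ennreal (1 / (V * r ^ (DIM('a) + 2)))
    * (\<integral>\<^sup>+ c. indicator {c. norm (fst c - snd c) \<le> 3 * r} c * diff_pow c \<partial>lborel)"

definition avg :: "real \<Rightarrow> 'a \<times> real \<Rightarrow> real" where
  "avg r y = (LINT b:cyl y r|lborel. u b) / vol r"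

lemma osc_measurable [measurable (raw)]:
  assumes [measurable]: "f \<in> M \<rightarrow>\<^sub>M borel" "g \<in> borel_measurable M"
  shows "(\<lambda>w. osc (f w) (g w)) \<in> borel_measurable M"
  unfolding osc_def vol_def by measurable

lemma avg_measurable [measurable (raw)]:
  assumes [measurable]: "f \<in> M \<rightarrow>\<^sub>M borel" "g \<in> borel_measurable M"
  shows "(\<lambda>w. avg (g w) (f w)) \<in> borel_measurable M"
proof -
  have "(\<lambda>w. avg (g w) (f w)) = (\<lambda>w. (LINT b|lborel. (enn2real (indicator (cyl (f w) (g w)) b)) * u b) / vol (g w))"
    by (auto simp: avg_def set_lebesgue_integral_def indicator_def fun_eq_iff
        intro!: Bochner_Integration.integral_cong)
  also have "\<dots> \<in> borel_measurable M" unfolding vol_def by measurable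
  finally show ?thesis .
qed

text \<open>
  For given \<open>a, b\<close>, the base points \<open>x\<close> whose cylinder contains both lie in a ball of radius \<open>r\<close>, and
  there are none unless \<open>|a - b| \<le> 3r\<close>.
\<close>

lemma integral_osc_le:
  assumes r: "r > 0"
  shows "(\<integral>\<^sup>+ x. osc (x, t) r \<partial>lborel) \<le> near_energy r"
proof -
  have "(\<integral>\<^sup>+ x. osc (x, t) r \<partial>lborel) = ennreal (1 / (vol r)\<^sup>2) *
     (\<integral>\<^sup>+ x. \<integral>\<^sup>+ c. indicator (cyl (x, t) r) (fst c) * indicator (cyl (x, t) r) (snd c)
         * diff_pow c \<partial>lborel \<partial>lborel)"
    unfolding osc_def by (intro nn_integral_cmult) measurable
  also have "(\<integral>\<^sup>+ x. \<integral>\<^sup>+ c. indicator (cyl (x, t) r) (fst c) * indicator (cyl (x, t) r) (snd c)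
      * diff_pow c \<partial>lborel \<partial>lborel)
     = (\<integral>\<^sup>+ c. \<integral>\<^sup>+ x. indicator (cyl (x, t) r) (fst c) * indicator (cyl (x, t) r) (snd c)
         * diff_pow c \<partial>lborel \<partial>lborel)"
    by (rule nn_integral_lborel_swap) measurable
  also have "\<dots> \<le> (\<integral>\<^sup>+ c. ennreal (V * r ^ DIM('a))
      * (indicator {c. norm (fst c - snd c) \<le> 3 * r} c * diff_pow c) \<partial>lborel)"
  proof (rule nn_integral_mono)
    fix c :: "('a \<times> real) \<times> ('a \<times> real)"
    have "indicator (cyl (x, t) r) (fst c) * indicator (cyl (x, t) r) (snd c) * diff_pow c
       \<le> (indicator {c. norm (fst c - snd c) \<le> 3 * r} c * diff_pow c) * indicator (cball (fst (fst c)) r) x" for x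
      using cyl_diam[of "fst c" "(x, t)" r "snd c"]
      by (auto simp: indicator_def in_cyl dist_norm)
    then have "(\<integral>\<^sup>+ x. indicator (cyl (x, t) r) (fst c) * indicator (cyl (x, t) r) (snd c) * diff_pow c \<partial>lborel)
      \<le> (\<integral>\<^sup>+ x. (indicator {c. norm (fst c - snd c) \<le> 3 * r} c * diff_pow c)
          * indicator (cball (fst (fst c)) r) x \<partial>lborel)"
      by (rule nn_integral_mono)
    also have "\<dots> = ennreal (V * r ^ DIM('a)) * (indicator {c. norm (fst c - snd c) \<le> 3 * r} c * diff_pow c)"
      by (subst nn_integral_cmult_indicator)
        (simp_all only: emeasure_cball[OF less_imp_le[OF r]] V_def mult.commute sets_lborel borel_closed[OF closed_cball])
    finally show "(\<integral>\<^sup>+ x. indicator (cyl (x, t) r) (fst c) * indicator (cyl (x, t) r) (snd c)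
        * diff_pow c \<partial>lborel) \<le> \<dots>" .
  qed
  also have "\<dots> = ennreal (V * r ^ DIM('a))
      * (\<integral>\<^sup>+ c. indicator {c. norm (fst c - snd c) \<le> 3 * r} c * diff_pow c \<partial>lborel)"
    by (intro nn_integral_cmult) measurable
  finally have "(\<integral>\<^sup>+ x. osc (x, t) r \<partial>lborel)
      \<le> ennreal (1 / (vol r)\<^sup>2)
      * (ennreal (V * r ^ DIM('a))
      * (\<integral>\<^sup>+ c. indicator {c. norm (fst c - snd c) \<le> 3 * r} c * diff_pow c \<partial>lborel))"
    by this (auto intro: mult_left_mono)
  also have "\<dots> = near_energy r"
  proof -
    have "1 / (vol r)\<^sup>2 * (V * r ^ DIM('a)) = 1 / (V * r ^ (DIM('a) + 2))"
      using r by (simp add: vol_def power2_eq_square field_simps)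
    then show ?thesis unfolding near_energy_def using r
      by (simp add: mult.assoc[symmetric] ennreal_mult'[symmetric])
  qed
  finally show ?thesis .
qed

text \<open>
  On pairs at distance at most \<open>3r\<close>, the constant \<open>1\<close> is at most \<open>(3r)\<^sup>\<alpha>\<close> times the Gagliardo kernel. The
  exponent \<open>sp - 1\<close> is what remains of \<open>\<alpha> = d + 1 + sp\<close> after division by \<open>r\<^bsup>d + 2\<^esup>\<close>.
\<close>

lemma near_energy_le:
  assumes r: "r > 0"
  shows "near_energy r \<le> ennreal (3 powr \<alpha> / V * r powr (s * p - 1)) * energy"
proof -
  have "(\<integral>\<^sup>+ c. indicator {c. norm (fst c - snd c) \<le> 3 * r} c * diff_pow c \<partial>lborel)
      \<le> ennreal ((3 * r) powr \<alpha>) * energy"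
  proof (rule kernel_le)
    fix a b :: "'a \<times> real" assume "a \<noteq> b"
    then show "indicator {c. norm (fst c - snd c) \<le> 3 * r} (a, b)
        \<le> ennreal ((3 * r) powr \<alpha> * norm (a - b) powr - \<alpha>)"
      using one_le_kernel[of a b r] by (auto simp: indicator_def)
  qed auto
  then have "near_energy r \<le> ennreal (1 / (V * r ^ (DIM('a) + 2))) * (ennreal ((3 * r) powr \<alpha>) * energy)"
    unfolding near_energy_def by (rule mult_left_mono) auto
  also have "\<dots> = ennreal (1 / (V * r ^ (DIM('a) + 2)) * (3 * r) powr \<alpha>) * energy"
    using V_pos r by (simp only: mult.assoc[symmetric], subst ennreal_mult') auto
  also have "1 / (V * r ^ (DIM('a) + 2)) * (3 * r) powr \<alpha> = 3 powr \<alpha> / V * r powr (s * p - 1)"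
  proof -
    have "r powr \<alpha> = r powr (s * p - 1) * r powr real (DIM('a) + 2)"
      by (simp add: powr_add[symmetric] \<alpha>_def add_ac)
    also have "r powr real (DIM('a) + 2) = r ^ (DIM('a) + 2)" using r by (rule powr_realpow)
    finally have "r powr \<alpha> = r powr (s * p - 1) * r ^ (DIM('a) + 2)" .
    moreover have "r ^ (DIM('a) + 2) \<noteq> 0" using r by simp
    ultimately show ?thesis using r V_pos by (simp only: powr_mult less_imp_le) (simp add: divide_simps)
  qed
  finally show ?thesis .
qed

lemma cyl_H: "snd y \<ge> 0 \<Longrightarrow> cyl y r \<subseteq> H"
  by (auto simp: cyl_def)

lemma osc_integral_fin:
  assumes r: "r > 0"
  shows "(\<integral>\<^sup>+ c. indicator (cyl y r) (fst c) * indicator (cyl y r) (snd c) * diff_pow c \<partial>lborel) < \<infinity>"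
proof -
  have "(\<integral>\<^sup>+ c. indicator (cyl y r) (fst c) * indicator (cyl y r) (snd c) * diff_pow c \<partial>lborel)
      \<le> ennreal ((3 * r) powr \<alpha>) * energy"
  proof (rule kernel_le)
    fix a b :: "'a \<times> real" assume "a \<noteq> b"
    then show "indicator (cyl y r) (fst (a, b)) * indicator (cyl y r) (snd (a, b))
        \<le> ennreal ((3 * r) powr \<alpha> * norm (a - b) powr - \<alpha>)"
      using cyl_diam[of a y r b] one_le_kernel[of a b r] by (auto simp: indicator_def)
  qed auto
  also have "\<dots> < \<infinity>" using energy_fin by (simp add: ennreal_mult_less_top)
  finally show ?thesis .
qed

text \<open>
  The double integral of \<open>|u(a) - u(b)|\<^sup>p\<close> over the cylinder is finite, hence so is the integral over \<open>b\<close>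
  for some \<open>a\<close> in the cylinder; and \<open>|u(b)| \<le> |u(a)| + 1 + |u(a) - u(b)|\<^sup>p\<close>.
\<close>

lemma integrable_cyl:
  assumes r: "r > 0" and y: "snd y \<ge> 0"
  shows "set_integrable lborel (cyl y r) u"
proof -
  let ?A = "cyl y r"
  have *: "(\<integral>\<^sup>+ a. \<integral>\<^sup>+ b. indicator ?A a * indicator ?A b * diff_pow (a, b) \<partial>lborel \<partial>lborel) < \<infinity>"
    using osc_integral_fin[OF r, of y] by (subst (asm) nn_integral_lborel_pair) simp_all
  have "AE a in lborel. (\<integral>\<^sup>+ b. indicator ?A a * indicator ?A b * diff_pow (a, b) \<partial>lborel) \<noteq> \<infinity>"
    by (rule nn_integral_PInf_AE) (use * in auto)
  moreover have "\<not> (AE a in lborel. a \<notin> ?A)"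
    using emeasure_cyl_vol[OF r, of y] vol_pos[OF r]
    by (subst AE_iff_measurable[where N = ?A]) auto
  ultimately obtain a where a: "a \<in> ?A" "(\<integral>\<^sup>+ b. indicator ?A a * indicator ?A b * diff_pow (a, b) \<partial>lborel) \<noteq> \<infinity>"
    by (metis (mono_tags, lifting) eventually_mono)
  have "(\<integral>\<^sup>+ b. ennreal (norm (indicator ?A b *\<^sub>R u b)) \<partial>lborel)
    \<le> (\<integral>\<^sup>+ b. ennreal (\<bar>u a\<bar> + 1) * indicator ?A b + indicator ?A a * indicator ?A b * diff_pow (a, b) \<partial>lborel)"
  proof (rule nn_integral_mono)
    fix b
    have "\<bar>u b\<bar> \<le> (\<bar>u a\<bar> + 1) + \<bar>u a - u b\<bar> powr p"
    proof (cases "\<bar>u a - u b\<bar> \<le> 1")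
      case False
      then have "\<bar>u a - u b\<bar> powr 1 \<le> \<bar>u a - u b\<bar> powr p" using p_ge by (intro powr_mono) auto
      then show ?thesis using False by simp
    qed (smt (verit) powr_ge_zero)
    then have "ennreal \<bar>u b\<bar> \<le> ennreal (\<bar>u a\<bar> + 1) + ennreal (\<bar>u a - u b\<bar> powr p)"
      by (simp flip: ennreal_plus add: ennreal_leI)
    then show "ennreal (norm (indicator ?A b *\<^sub>R u b))
        \<le> ennreal (\<bar>u a\<bar> + 1) * indicator ?A b + indicator ?A a * indicator ?A b * diff_pow (a, b)"
      using a(1) cyl_H[OF y, of r] by (auto simp: indicator_def diff_pow_def)
  qed
  also have "\<dots> = ennreal (\<bar>u a\<bar> + 1) * emeasure lborel ?A
      + (\<integral>\<^sup>+ b. indicator ?A a * indicator ?A b * diff_pow (a, b) \<partial>lborel)"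
    by (subst nn_integral_add) (auto simp: nn_integral_cmult_indicator)
  also have "\<dots> < \<infinity>"
    using a(2) r by (auto simp: emeasure_cyl_vol less_top ennreal_mult_less_top ennreal_mult_eq_top_iff)
  finally show ?thesis unfolding set_integrable_def by (intro integrableI_bounded) auto
qed

lemma average_point_le:
  assumes r: "r > 0" and y: "snd y \<ge> 0" and a: "a \<in> H"
  shows "ennreal (\<bar>u a - avg r y\<bar> powr p)
      \<le> ennreal (1 / vol r) * (\<integral>\<^sup>+ b. indicator (cyl y r) b * diff_pow (a, b) \<partial>lborel)"
proof -
  have "ennreal (\<bar>avg r y - u a\<bar> powr p)
      \<le> ennreal (1 / vol r) * (\<integral>\<^sup>+ b. indicator (cyl y r) b * ennreal (\<bar>u b - u a\<bar> powr p) \<partial>lborel)"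
    unfolding avg_def using r vol_pos[OF r]
    by (intro jensen_average p_ge integrable_cyl[OF r y]) (auto simp: emeasure_cyl_vol)
  also have "(\<integral>\<^sup>+ b. indicator (cyl y r) b * ennreal (\<bar>u b - u a\<bar> powr p) \<partial>lborel)
      = (\<integral>\<^sup>+ b. indicator (cyl y r) b * diff_pow (a, b) \<partial>lborel)"
    using a cyl_H[OF y, of r] by (intro nn_integral_cong) (auto simp: diff_pow_def indicator_def abs_minus_commute)
  finally show ?thesis by (simp add: abs_minus_commute)
qed

text \<open>
  Jensen's inequality is used once in each variable. The factor is the largest possible ratio of the
  volumes of the two cylinders.
\<close>

lemma average_diff_le:
  assumes r: "r' > 0" "r \<le> 2 * r'" "r > 0" and y: "snd y \<ge> 0" and y': "snd y' \<ge> 0" and sub: "cyl y' r' \<subseteq> cyl y r"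
  shows "ennreal (\<bar>avg r' y' - avg r y\<bar> powr p) \<le> ennreal (2 ^ Suc DIM('a)) * osc y r"
proof -
  have "ennreal (\<bar>avg r' y' - avg r y\<bar> powr p)
      \<le> ennreal (1 / vol r') * (\<integral>\<^sup>+ a. indicator (cyl y' r') a * ennreal (\<bar>u a - avg r y\<bar> powr p) \<partial>lborel)"
    unfolding avg_def[of r'] using r vol_pos[OF r(1)]
    by (intro jensen_average p_ge integrable_cyl[OF _ y']) (auto simp: emeasure_cyl_vol)
  also have "(\<integral>\<^sup>+ a. indicator (cyl y' r') a * ennreal (\<bar>u a - avg r y\<bar> powr p) \<partial>lborel)
     \<le> (\<integral>\<^sup>+ a. ennreal (1 / vol r)
         * (\<integral>\<^sup>+ b. indicator (cyl y r) a * indicator (cyl y r) b * diff_pow (a, b) \<partial>lborel) \<partial>lborel)"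
  proof (rule nn_integral_mono)
    fix a show "indicator (cyl y' r') a * ennreal (\<bar>u a - avg r y\<bar> powr p)
        \<le> ennreal (1 / vol r) * (\<integral>\<^sup>+ b. indicator (cyl y r) a * indicator (cyl y r) b * diff_pow (a, b) \<partial>lborel)"
    proof (cases "a \<in> cyl y' r'")
      case True
      then have "a \<in> cyl y r" "a \<in> H" using cyl_H[OF y, of r] sub by auto
      then show ?thesis using average_point_le[OF r(3) y, of a] True by simp
    qed simp
  qed
  also have "\<dots> = ennreal (1 / vol r)
      * (\<integral>\<^sup>+ a. (\<integral>\<^sup>+ b. indicator (cyl y r) a * indicator (cyl y r) b * diff_pow (a, b) \<partial>lborel) \<partial>lborel)"
    by (rule nn_integral_cmult) measurable
  also have "(\<integral>\<^sup>+ a. (\<integral>\<^sup>+ b. indicator (cyl y r) a * indicator (cyl y r) b * diff_pow (a, b) \<partial>lborel) \<partial>lborel)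
     = (\<integral>\<^sup>+ c. indicator (cyl y r) (fst c) * indicator (cyl y r) (snd c) * diff_pow c \<partial>lborel)" (is "_ = ?I")
    by (subst nn_integral_lborel_pair) simp_all
  finally have "ennreal (\<bar>avg r' y' - avg r y\<bar> powr p) \<le> ennreal (1 / vol r') * (ennreal (1 / vol r) * ?I)"
    by this (auto intro: mult_left_mono)
  also have "\<dots> \<le> ennreal (2 ^ Suc DIM('a) / vol r) * (ennreal (1 / vol r) * ?I)"
  proof (intro mult_right_mono ennreal_leI)
    have "r ^ Suc DIM('a) \<le> (2 * r') ^ Suc DIM('a)" using r by (intro power_mono) auto
    also have "\<dots> = 2 ^ Suc DIM('a) * r' ^ Suc DIM('a)" by (rule power_mult_distrib)
    finally have "vol r \<le> 2 ^ Suc DIM('a) * vol r'"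
      using mult_left_mono[OF _ less_imp_le[OF V_pos]] by (simp only: vol_def mult.left_commute)
    then show "1 / vol r' \<le> 2 ^ Suc DIM('a) / vol r"
      using vol_pos[OF r(1)] vol_pos[OF r(3)] by (simp add: field_simps)
  qed auto
  also have "\<dots> = ennreal (2 ^ Suc DIM('a)) * osc y r"
  proof -
    have "2 ^ Suc DIM('a) / vol r * (1 / vol r) = 2 ^ Suc DIM('a) * (1 / (vol r)\<^sup>2)"
      by (simp add: power2_eq_square)
    then show ?thesis unfolding osc_def using vol_pos[OF r(3)]
      by (simp only: mult.assoc[symmetric])
        (simp only: ennreal_mult'[symmetric] less_imp_le divide_nonneg_pos
            zero_le_power zero_le_numeral zero_le_one)
  qed
  finally show ?thesis .
qed

end

section \<open>Dyadic scales and the existence of the trace\<close>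

text \<open>
  The trace is a limit along the scales \<open>2\<^sup>-\<^sup>k\<close>. To reach it from a scale comparable to a given length, that
  length is rounded up to an integer power of \<open>2\<close>.
\<close>

definition dyadic :: "real \<Rightarrow> real" where
  "dyadic t = 2 powr real_of_int \<lceil>log 2 t\<rceil>"

lemma dyadic_measurable [measurable]: "dyadic \<in> borel_measurable borel"
  unfolding dyadic_def[abs_def] by measurable

lemma dyadic_pos [simp]: "dyadic t > 0"
  by (simp add: dyadic_def)

lemma dyadic_bounds:
  assumes "t > 0"
  shows "t \<le> dyadic t" "dyadic t \<le> 2 * t"
proof -
  have "2 powr log 2 t \<le> dyadic t" unfolding dyadic_def by (intro powr_mono) auto
  then show "t \<le> dyadic t" using assms by simp
  have "dyadic t \<le> 2 powr (log 2 t + 1)" unfolding dyadic_def by (intro powr_mono) linarith+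
  then show "dyadic t \<le> 2 * t" using assms by (simp add: powr_add)
qed

lemma dyadic_subsequence:
  fixes f :: "real \<Rightarrow> real"
  assumes "(\<lambda>k. f (1 / 2 ^ k)) \<longlonglongrightarrow> l"
  shows "(\<lambda>k. f (dyadic t / 2 ^ k)) \<longlonglongrightarrow> l"
proof -
  \<comment> \<open>The two sequences differ by a shift of the index by \<open>j\<close>, to the left or to the right.\<close>
  define j where "j = \<lceil>log 2 t\<rceil>"
  have "(\<lambda>k. f (dyadic t / 2 ^ (k + nat j))) = (\<lambda>k. f (1 / 2 ^ (k + nat (- j))))"
  proof
    fix k
    have "dyadic t / 2 ^ (k + nat j) = 2 powr (real_of_int j - real (k + nat j))"
      by (simp only: powr_diff powr_realpow dyadic_def j_def zero_less_numeral)
    also have "real_of_int j - real (k + nat j) = - real (k + nat (- j))" by simp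
    also have "2 powr \<dots> = 1 / 2 ^ (k + nat (- j))"
      by (simp only: powr_minus_divide powr_realpow zero_less_numeral)
    finally show "f (dyadic t / 2 ^ (k + nat j)) = f (1 / 2 ^ (k + nat (- j)))" by simp
  qed
  moreover have "(\<lambda>k. f (1 / 2 ^ (k + nat (- j)))) \<longlonglongrightarrow> l"
    using assms by (rule LIMSEQ_ignore_initial_segment)
  ultimately have "(\<lambda>k. f (dyadic t / 2 ^ (k + nat j))) \<longlonglongrightarrow> l" by simp
  then show ?thesis by (rule LIMSEQ_offset)
qed

definition telescope_const :: "real \<Rightarrow> real \<Rightarrow> real" where
  "telescope_const \<epsilon> p = (1 - 2 powr (- \<epsilon> / p)) powr - p"

context sobolev_fun
begin

definition \<epsilon> :: real where "\<epsilon> = (s * p - 1) / 2"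

lemma \<epsilon>_pos: "\<epsilon> > 0" using sp by (simp add: \<epsilon>_def)

text \<open>
  The weights grow geometrically, yet more slowly than the oscillations decay: their integrals over
  \<open>x\<close> are of order \<open>2\<^bsup>-2k\<epsilon>\<^esup>\<close>.
\<close>

definition osc_series :: "'a \<times> real \<Rightarrow> real \<Rightarrow> ennreal" where
  "osc_series y r = (\<Sum>k. ennreal (2 powr (real k * \<epsilon>)) * osc y (r / 2 ^ k))"

lemma osc_series_measurable [measurable (raw)]:
  assumes [measurable]: "f \<in> M \<rightarrow>\<^sub>M borel" "g \<in> borel_measurable M"
  shows "(\<lambda>w. osc_series (f w) (g w)) \<in> borel_measurable M"
  unfolding osc_series_def by measurable

lemma osc_series_telescope:
  assumes r: "r > 0" and y: "snd y \<ge> 0"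
  shows "osc_series y r < \<infinity> \<Longrightarrow> convergent (\<lambda>k. avg (r / 2 ^ k) y)"
    and "(\<lambda>k. avg (r / 2 ^ k) y) \<longlonglongrightarrow> l \<Longrightarrow>
      ennreal (\<bar>avg r y - l\<bar> powr p) \<le> ennreal (telescope_const \<epsilon> p * 2 ^ Suc DIM('a)) * osc_series y r"
proof -
  let ?f = "\<lambda>k. avg (r / 2 ^ k) y"
  let ?S = "\<Sum>k. ennreal (2 powr (real k * \<epsilon>)) * ennreal (\<bar>?f (Suc k) - ?f k\<bar> powr p)"
  have "?S \<le> (\<Sum>k. ennreal (2 ^ Suc DIM('a)) * (ennreal (2 powr (real k * \<epsilon>)) * osc y (r / 2 ^ k)))"
  proof (intro suminf_le summableI)
    fix k
    have "cyl y (r / 2 ^ Suc k) \<subseteq> cyl y (r / 2 ^ k)" using r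
      by (auto simp: in_cyl field_simps elim!: order_trans)
    then have "ennreal (\<bar>?f (Suc k) - ?f k\<bar> powr p) \<le> ennreal (2 ^ Suc DIM('a)) * osc y (r / 2 ^ k)"
      using r y by (intro average_diff_le) auto
    then have "ennreal (2 powr (real k * \<epsilon>)) * ennreal (\<bar>?f (Suc k) - ?f k\<bar> powr p)
        \<le> ennreal (2 powr (real k * \<epsilon>)) * (ennreal (2 ^ Suc DIM('a)) * osc y (r / 2 ^ k))"
      by (rule mult_left_mono) simp
    then show "ennreal (2 powr (real k * \<epsilon>)) * ennreal (\<bar>?f (Suc k) - ?f k\<bar> powr p)
        \<le> ennreal (2 ^ Suc DIM('a)) * (ennreal (2 powr (real k * \<epsilon>)) * osc y (r / 2 ^ k))"
      by (simp only: mult.left_commute)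
  qed
  also have "\<dots> = ennreal (2 ^ Suc DIM('a)) * osc_series y r" unfolding osc_series_def by (rule ennreal_suminf_cmult)
  finally have S: "?S \<le> ennreal (2 ^ Suc DIM('a)) * osc_series y r" .
  have p0: "p > 0" using p_ge by simp
  have Sfin: "?S < \<infinity>" if "osc_series y r < \<infinity>"
    using S that by (auto intro: le_less_trans simp: ennreal_mult_less_top simp del: power_Suc)
  then show "osc_series y r < \<infinity> \<Longrightarrow> convergent (\<lambda>k. avg (r / 2 ^ k) y)"
    using telescope_powr(1)[OF p0 \<epsilon>_pos, of ?f] by blast
  assume l: "(\<lambda>k. avg (r / 2 ^ k) y) \<longlonglongrightarrow> l"
  have tc: "telescope_const \<epsilon> p > 0"
    using \<epsilon>_pos p0 by (auto simp: telescope_const_def powr_less_one)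
  show "ennreal (\<bar>avg r y - l\<bar> powr p) \<le> ennreal (telescope_const \<epsilon> p * 2 ^ Suc DIM('a)) * osc_series y r"
  proof (cases "osc_series y r < \<infinity>")
    case True
    have "ennreal (\<bar>avg r y - l\<bar> powr p) \<le> ennreal (telescope_const \<epsilon> p) * ?S"
      using telescope_powr(2)[OF p0 \<epsilon>_pos Sfin[OF True] l] by (simp add: telescope_const_def)
    also have "\<dots> \<le> ennreal (telescope_const \<epsilon> p) * (ennreal (2 ^ Suc DIM('a)) * osc_series y r)"
      using S by (rule mult_left_mono) simp
    also have "\<dots> = ennreal (telescope_const \<epsilon> p * 2 ^ Suc DIM('a)) * osc_series y r"
      using tc by (simp only: mult.assoc[symmetric], subst ennreal_mult') auto
    finally show ?thesis .
  next
    case False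
    then have "osc_series y r = top" by (metis less_top infinity_ennreal_def)
    then show ?thesis using tc by (simp add: ennreal_mult_top)
  qed
qed

lemma integral_osc_series_le:
  assumes r: "r > 0"
  shows "(\<integral>\<^sup>+ x. osc_series (x, t) r \<partial>lborel)
      \<le> ennreal (3 powr \<alpha> / V / (1 - 2 powr - \<epsilon>) * r powr (s * p - 1)) * energy"
proof -
  have "(\<integral>\<^sup>+ x. osc_series (x, t) r \<partial>lborel)
      = (\<Sum>k. \<integral>\<^sup>+ x. ennreal (2 powr (real k * \<epsilon>)) * osc (x, t) (r / 2 ^ k) \<partial>lborel)"
    unfolding osc_series_def by (rule nn_integral_suminf) measurable
  also have "\<dots> = (\<Sum>k. ennreal (2 powr (real k * \<epsilon>)) * (\<integral>\<^sup>+ x. osc (x, t) (r / 2 ^ k) \<partial>lborel))"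
    by (intro suminf_cong nn_integral_cmult) measurable
  also have "\<dots> \<le> (\<Sum>k. ennreal (3 powr \<alpha> / V * r powr (s * p - 1) * 2 powr - (real k * \<epsilon>)) * energy)"
  proof (intro suminf_le summableI)
    fix k
    have rk: "r / 2 ^ k > 0" using r by simp
    have "(\<integral>\<^sup>+ x. osc (x, t) (r / 2 ^ k) \<partial>lborel) \<le> ennreal (3 powr \<alpha> / V * (r / 2 ^ k) powr (s * p - 1)) * energy"
      using order_trans[OF integral_osc_le[OF rk] near_energy_le[OF rk]] .
    then have "ennreal (2 powr (real k * \<epsilon>)) * (\<integral>\<^sup>+ x. osc (x, t) (r / 2 ^ k) \<partial>lborel)
        \<le> ennreal (2 powr (real k * \<epsilon>)) * (ennreal (3 powr \<alpha> / V * (r / 2 ^ k) powr (s * p - 1)) * energy)"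
      by (rule mult_left_mono) simp
    also have "\<dots> = ennreal (2 powr (real k * \<epsilon>) * (3 powr \<alpha> / V * (r / 2 ^ k) powr (s * p - 1))) * energy"
      by (rule ennreal_mult_fold) simp
    also have "2 powr (real k * \<epsilon>) * (3 powr \<alpha> / V * (r / 2 ^ k) powr (s * p - 1))
        = 3 powr \<alpha> / V * r powr (s * p - 1) * 2 powr - (real k * \<epsilon>)"
    proof -
      have "(r / 2 ^ k) powr (s * p - 1) = r powr (s * p - 1) * 2 powr - (real k * (2 * \<epsilon>))"
      proof -
        have "2 * \<epsilon> = s * p - 1" by (simp add: \<epsilon>_def)
        then show ?thesis
          using r by (simp add: powr_divide powr_realpow[symmetric] powr_powr powr_minus_divide)
      qed
      moreover have "2 powr (real k * \<epsilon>) * 2 powr - (real k * (2 * \<epsilon>)) = 2 powr - (real k * \<epsilon>)"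
        by (simp add: powr_add[symmetric])
      ultimately show ?thesis by (simp add: ac_simps)
    qed
    finally show "ennreal (2 powr (real k * \<epsilon>)) * (\<integral>\<^sup>+ x. osc (x, t) (r / 2 ^ k) \<partial>lborel)
        \<le> ennreal (3 powr \<alpha> / V * r powr (s * p - 1) * 2 powr - (real k * \<epsilon>)) * energy" .
  qed
  also have "\<dots> = (\<Sum>k. ennreal (3 powr \<alpha> / V * r powr (s * p - 1) * 2 powr - (real k * \<epsilon>))) * energy"
    by (rule ennreal_suminf_multc)
  also have "\<dots> = ennreal (3 powr \<alpha> / V * r powr (s * p - 1) / (1 - 2 powr - \<epsilon>)) * energy"
    using V_pos by (subst suminf_geometric_weight[OF \<epsilon>_pos]) auto
  finally show ?thesis by (simp add: ac_simps)
qed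

text \<open>
  Almost everywhere on every horizontal hyperplane, not only for almost every height. On the boundary,
  this gives the existence of the trace.
\<close>

lemma avg_convergent: "AE x in lborel. convergent (\<lambda>k. avg (1 / 2 ^ k) (x, t))" if "t \<ge> 0"
proof -
  have "(\<integral>\<^sup>+ x. osc_series (x, t) 1 \<partial>lborel) < \<infinity>"
    using integral_osc_series_le[of 1 t] energy_fin by (auto elim!: le_less_trans simp: ennreal_mult_less_top)
  then have "AE x in lborel. osc_series (x, t) 1 \<noteq> \<infinity>"
    by (intro nn_integral_PInf_AE) auto
  then show ?thesis
    by eventually_elim (use osc_series_telescope(1)[of 1] that in \<open>auto simp: less_top\<close>)
qed

text \<open>
  Where the averages diverge, the value is arbitrary; these points form a null set.
\<close>

definition v :: "'a \<Rightarrow> real" where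
  "v x = lim (\<lambda>k. avg (1 / 2 ^ k) (x, 0))"

lemma v_measurable [measurable]: "v \<in> borel_measurable borel"
  unfolding v_def[abs_def] by measurable

lemma avg_tendsto_v: "AE x in lborel. (\<lambda>k. avg (1 / 2 ^ k) (x, 0)) \<longlonglongrightarrow> v x"
  using avg_convergent[of 0] by (simp add: v_def convergent_LIMSEQ_iff)

definition rate :: real where
  "rate = telescope_const \<epsilon> p * 2 ^ Suc DIM('a) * (3 powr \<alpha> / V / (1 - 2 powr - \<epsilon>))"

lemma rate_nonneg: "rate \<ge> 0"
  using \<epsilon>_pos V_pos unfolding rate_def
  by (intro mult_nonneg_nonneg divide_nonneg_pos) (auto simp: telescope_const_def powr_less_one)

lemma integral_average_limit_le:
  assumes t: "t \<ge> 0" and l: "AE x in lborel. (\<lambda>k. avg (1 / 2 ^ k) (x, t)) \<longlonglongrightarrow> l x"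
  shows "(\<integral>\<^sup>+ x. ennreal (\<bar>avg (dyadic r) (x, t) - l x\<bar> powr p) \<partial>lborel)
     \<le> ennreal (rate * dyadic r powr (s * p - 1)) * energy"
proof -
  have tc: "telescope_const \<epsilon> p \<ge> 0" by (simp add: telescope_const_def)
  have "(\<integral>\<^sup>+ x. ennreal (\<bar>avg (dyadic r) (x, t) - l x\<bar> powr p) \<partial>lborel)
     \<le> (\<integral>\<^sup>+ x. ennreal (telescope_const \<epsilon> p * 2 ^ Suc DIM('a)) * osc_series (x, t) (dyadic r) \<partial>lborel)"
    using l by (intro nn_integral_mono_AE, eventually_elim)
      (rule osc_series_telescope(2), use t in \<open>auto intro: dyadic_subsequence\<close>)
  also have "\<dots> = ennreal (telescope_const \<epsilon> p * 2 ^ Suc DIM('a)) * (\<integral>\<^sup>+ x. osc_series (x, t) (dyadic r) \<partial>lborel)"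
    by (intro nn_integral_cmult) measurable
  also have "\<dots> \<le> ennreal (telescope_const \<epsilon> p * 2 ^ Suc DIM('a))
      * (ennreal (3 powr \<alpha> / V / (1 - 2 powr - \<epsilon>) * dyadic r powr (s * p - 1)) * energy)"
    by (intro mult_left_mono integral_osc_series_le) auto
  also have "\<dots> = ennreal (rate * dyadic r powr (s * p - 1)) * energy"
    using tc unfolding rate_def by (subst ennreal_mult_fold) (auto simp: mult.assoc)
  finally show ?thesis .
qed

text \<open>
  Unlike in the estimate on a single hyperplane, here one also integrates over the height, which gains
  one power of \<open>r\<close>.
\<close>

lemma integral_average_interior_le:
  assumes r: "r > 0"
  shows "(\<integral>\<^sup>+ y. indicator H y * ennreal (\<bar>u y - avg r y\<bar> powr p) \<partial>lborel)
      \<le> ennreal (3 powr \<alpha> / V * r powr (s * p)) * energy"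
proof -
  have "(\<integral>\<^sup>+ y. indicator H y * ennreal (\<bar>u y - avg r y\<bar> powr p) \<partial>lborel)
     \<le> (\<integral>\<^sup>+ y. ennreal (1 / vol r) * (\<integral>\<^sup>+ b. indicator (cyl y r) b * diff_pow (y, b) \<partial>lborel) \<partial>lborel)"
  proof (rule nn_integral_mono)
    fix y show "indicator H y * ennreal (\<bar>u y - avg r y\<bar> powr p)
        \<le> ennreal (1 / vol r) * (\<integral>\<^sup>+ b. indicator (cyl y r) b * diff_pow (y, b) \<partial>lborel)"
    proof (cases "y \<in> H")
      case True
      then have "snd y \<ge> 0" by auto
      then show ?thesis using average_point_le[OF r, of y y] True by simp
    qed simp
  qed
  also have "\<dots> = ennreal (1 / vol r) * (\<integral>\<^sup>+ y. (\<integral>\<^sup>+ b. indicator (cyl y r) b * diff_pow (y, b) \<partial>lborel) \<partial>lborel)"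
    by (rule nn_integral_cmult) measurable
  also have "(\<integral>\<^sup>+ y. (\<integral>\<^sup>+ b. indicator (cyl y r) b * diff_pow (y, b) \<partial>lborel) \<partial>lborel)
      = (\<integral>\<^sup>+ c. indicator (cyl (fst c) r) (snd c) * diff_pow c \<partial>lborel)"
    by (subst nn_integral_lborel_pair) simp_all
  also have "ennreal (1 / vol r) * \<dots> \<le> ennreal (1 / vol r) * (ennreal ((3 * r) powr \<alpha>) * energy)"
  proof (intro mult_left_mono kernel_le)
    fix a b :: "'a \<times> real" assume ne: "a \<noteq> b"
    have "norm (a - b) \<le> 3 * r" if "b \<in> cyl a r"
    proof -
      have "norm (a - b) \<le> norm (fst a - fst b) + norm (snd a - snd b)"
        by (metis fst_diff norm_Pair_le prod.collapse snd_diff)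
      also have "\<dots> \<le> 3 * r" using that r by (auto simp: in_cyl norm_minus_commute)
      finally show ?thesis .
    qed
    then show "indicator (cyl (fst (a, b)) r) (snd (a, b)) \<le> ennreal ((3 * r) powr \<alpha> * norm (a - b) powr - \<alpha>)"
      using one_le_kernel[OF ne, of r] by (auto simp: indicator_def)
  qed auto
  also have "\<dots> = ennreal (1 / vol r * (3 * r) powr \<alpha>) * energy"
    using vol_pos[OF r] by (simp only: mult.assoc[symmetric], subst ennreal_mult') auto
  also have "1 / vol r * (3 * r) powr \<alpha> = 3 powr \<alpha> / V * r powr (s * p)"
  proof -
    have "r powr \<alpha> = r powr (s * p) * r powr real (Suc DIM('a))"
      by (simp add: powr_add[symmetric] \<alpha>_def add_ac)
    also have "r powr real (Suc DIM('a)) = r ^ Suc DIM('a)" using r by (rule powr_realpow)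
    finally have "r powr \<alpha> = r powr (s * p) * r ^ Suc DIM('a)" .
    moreover have "r ^ Suc DIM('a) \<noteq> 0" using r by simp
    ultimately show ?thesis using r V_pos by (simp only: powr_mult less_imp_le vol_def) (simp add: divide_simps)
  qed
  finally show ?thesis .
qed

text \<open>
  The \<open>p\<close>-th powers of the errors have integrals over the half space that are summable over the dyadic
  scales; hence their series converges almost everywhere, and Fubini's theorem passes to slices.
  Summability stands in for Lebesgue's differentiation theorem.
\<close>

lemma avg_tendsto_slice:
  "AE t in lborel. t > 0 \<longrightarrow> (AE x in lborel. (\<lambda>k. avg (1 / 2 ^ k) (x, t)) \<longlonglongrightarrow> u (x, t))"
proof -
  define F where "F y = (\<Sum>k. indicator H y * ennreal (\<bar>u y - avg (1 / 2 ^ k) y\<bar> powr p))" for y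
  have [measurable]: "F \<in> borel_measurable borel" unfolding F_def[abs_def] by measurable
  have "(\<integral>\<^sup>+ y. F y \<partial>lborel) = (\<Sum>k. \<integral>\<^sup>+ y. indicator H y * ennreal (\<bar>u y - avg (1 / 2 ^ k) y\<bar> powr p) \<partial>lborel)"
    unfolding F_def by (rule nn_integral_suminf) measurable
  also have "\<dots> \<le> (\<Sum>k. ennreal (3 powr \<alpha> / V * 2 powr - (real k * (s * p))) * energy)"
  proof (intro suminf_le summableI)
    fix k
    have "(1 / 2 ^ k) powr (s * p) = 2 powr - (real k * (s * p))"
      by (simp add: powr_divide powr_realpow[symmetric] powr_powr powr_minus_divide)
    then show "(\<integral>\<^sup>+ y. indicator H y * ennreal (\<bar>u y - avg (1 / 2 ^ k) y\<bar> powr p) \<partial>lborel)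
        \<le> ennreal (3 powr \<alpha> / V * 2 powr - (real k * (s * p))) * energy"
      using integral_average_interior_le[of "1 / 2 ^ k"] by simp
  qed
  also have "\<dots> = (\<Sum>k. ennreal (3 powr \<alpha> / V * 2 powr - (real k * (s * p)))) * energy"
    by (rule ennreal_suminf_multc)
  also have "\<dots> < \<infinity>"
    using V_pos sp energy_fin by (subst suminf_geometric_weight) (auto simp: ennreal_mult_less_top)
  finally have Ffin: "(\<integral>\<^sup>+ y. F y \<partial>lborel) < \<infinity>" .
  have lim: "(\<lambda>k. avg (1 / 2 ^ k) y) \<longlonglongrightarrow> u y" if y: "y \<in> H" and fin: "F y < \<infinity>" for y
  proof -
    have "summable (\<lambda>k. \<bar>u y - avg (1 / 2 ^ k) y\<bar> powr p)"
      using fin y unfolding F_def by (intro summable_suminf_not_top) auto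
    then have "(\<lambda>k. \<bar>u y - avg (1 / 2 ^ k) y\<bar> powr p) \<longlonglongrightarrow> 0" by (rule summable_LIMSEQ_zero)
    then have "(\<lambda>k. (\<bar>u y - avg (1 / 2 ^ k) y\<bar> powr p) powr (1 / p)) \<longlonglongrightarrow> 0 powr (1 / p)"
      using p_ge by (intro tendsto_powr2 tendsto_const) auto
    then have "(\<lambda>k. \<bar>u y - avg (1 / 2 ^ k) y\<bar>) \<longlonglongrightarrow> 0" using p_ge by (simp add: powr_powr)
    then have "(\<lambda>k. u y - avg (1 / 2 ^ k) y) \<longlonglongrightarrow> 0" by (simp add: tendsto_rabs_zero_iff)
    from tendsto_diff[OF tendsto_const[of "u y"] this] show ?thesis by simp
  qed
  have "(\<integral>\<^sup>+ t. \<integral>\<^sup>+ x. F (x, t) \<partial>lborel \<partial>lborel) = (\<integral>\<^sup>+ y. F y \<partial>lborel)"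
    by (subst nn_integral_lborel_pair) (auto intro: nn_integral_lborel_swap[symmetric])
  then have "AE t in lborel. (\<integral>\<^sup>+ x. F (x, t) \<partial>lborel) \<noteq> \<infinity>"
    using Ffin by (intro nn_integral_PInf_AE) auto
  then show ?thesis
  proof (eventually_elim, intro impI)
    fix t :: real assume t: "(\<integral>\<^sup>+ x. F (x, t) \<partial>lborel) \<noteq> \<infinity>" "t > 0"
    then have "AE x in lborel. F (x, t) \<noteq> \<infinity>" by (intro nn_integral_PInf_AE) auto
    then show "AE x in lborel. (\<lambda>k. avg (1 / 2 ^ k) (x, t)) \<longlonglongrightarrow> u (x, t)"
      by eventually_elim (use lim t in \<open>auto simp: less_top\<close>)
  qed
qed

text \<open>
  At a dyadic scale \<open>r\<close> with \<open>t \<le> r \<le> 2t\<close>, pass from \<open>u(x, t)\<close> to the average over the cylinder of size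
  \<open>r\<close> on \<open>(x, t)\<close>, then to the average over the cylinder of size \<open>2r\<close> on \<open>(x, 0)\<close>, which contains the
  former because \<open>t \<le> r\<close>, and from there to \<open>v(x)\<close>.
\<close>

lemma slice_distance_le:
  assumes t: "t > 0" and l: "AE x in lborel. (\<lambda>k. avg (1 / 2 ^ k) (x, t)) \<longlonglongrightarrow> u (x, t)"
  shows "(\<integral>\<^sup>+ x. ennreal (\<bar>u (x, t) - v x\<bar> powr p) \<partial>lborel)
    \<le> ennreal (4 powr p * (2 * rate + 2 ^ Suc DIM('a) * (3 powr \<alpha> / V)) * (4 * t) powr (s * p - 1)) * energy"
proof -
  define r where "r = dyadic t"
  have r: "r > 0" "t \<le> r" "2 * r \<le> 4 * t" using dyadic_bounds[OF t] by (auto simp: r_def)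
  have r2: "dyadic (2 * t) = 2 * r" using t by (simp add: r_def dyadic_def log_mult powr_add add.commute[of 1])
  let ?q = "(4 * t) powr (s * p - 1)" and ?K = "2 ^ Suc DIM('a) * (3 powr \<alpha> / V)"
  have mono: "ennreal (c * x powr (s * p - 1)) * energy \<le> ennreal (c * ?q) * energy"
      if "0 \<le> c" "0 \<le> x" "x \<le> 4 * t" for c x
    using that sp by (intro mult_right_mono ennreal_leI mult_left_mono powr_mono2) auto
  note rate = rate_nonneg
  let ?f1 = "\<lambda>x. ennreal (\<bar>u (x, t) - avg r (x, t)\<bar> powr p)"
  let ?f2 = "\<lambda>x. ennreal (\<bar>avg r (x, t) - avg (2 * r) (x, 0)\<bar> powr p)"
  let ?f3 = "\<lambda>x. ennreal (\<bar>avg (2 * r) (x, 0) - v x\<bar> powr p)"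
  have i1: "(\<integral>\<^sup>+ x. ?f1 x \<partial>lborel) \<le> ennreal (rate * ?q) * energy"
    using order_trans[OF integral_average_limit_le[OF _ l, of t] mono[OF rate]] t r
        by (simp add: r_def[symmetric] abs_minus_commute)
  have i3: "(\<integral>\<^sup>+ x. ?f3 x \<partial>lborel) \<le> ennreal (rate * ?q) * energy"
    using order_trans[OF integral_average_limit_le[OF _ avg_tendsto_v, of "2 * t"] mono[OF rate]] t r
        by (simp add: r2)
  have i2: "(\<integral>\<^sup>+ x. ?f2 x \<partial>lborel) \<le> ennreal (?K * ?q) * energy"
  proof -
    have "(\<integral>\<^sup>+ x. ?f2 x \<partial>lborel) \<le> (\<integral>\<^sup>+ x. ennreal (2 ^ Suc DIM('a)) * osc (x, 0) (2 * r) \<partial>lborel)"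
    proof (intro nn_integral_mono average_diff_le)
      show "cyl (x, t) r \<subseteq> cyl (x, 0) (2 * r)" for x :: 'a using r t by (auto simp: in_cyl)
    qed (use r t in auto)
    also have "\<dots> = ennreal (2 ^ Suc DIM('a)) * (\<integral>\<^sup>+ x. osc (x, 0) (2 * r) \<partial>lborel)"
      by (rule nn_integral_cmult) measurable
    also have "\<dots> \<le> ennreal (2 ^ Suc DIM('a)) * (ennreal (3 powr \<alpha> / V * (2 * r) powr (s * p - 1)) * energy)"
      using r by (intro mult_left_mono order_trans[OF integral_osc_le near_energy_le]) auto
    also have "\<dots> = ennreal (?K * (2 * r) powr (s * p - 1)) * energy"
      by (subst ennreal_mult_fold) (auto simp: mult.assoc)
    also have "\<dots> \<le> ennreal (?K * ?q) * energy" using r V_pos by (intro mono) auto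
    finally show ?thesis .
  qed
  have "ennreal (\<bar>u (x, t) - v x\<bar> powr p) \<le> ennreal (4 powr p) * (?f1 x + (?f2 x + ?f3 x))" for x
  proof -
    have p0: "p \<ge> 0" using p_ge by simp
    have "ennreal 1 \<le> ennreal (2 powr p)" using p0 by (intro ennreal_leI ge_one_powr_ge_zero) auto
    then have one: "?f1 x \<le> ennreal (2 powr p) * ?f1 x"
        using mult_right_mono[of 1 "ennreal (2 powr p)" "?f1 x"] by simp
    have "ennreal (\<bar>u (x, t) - v x\<bar> powr p) \<le> ennreal (2 powr p) * (?f1 x + ennreal (\<bar>avg r (x, t) - v x\<bar> powr p))"
      by (rule ennreal_abs_triangle_powr[OF p0])
    also have "\<dots> \<le> ennreal (2 powr p) * (ennreal (2 powr p) * ?f1 x + ennreal (2 powr p) * (?f2 x + ?f3 x))"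
      by (intro mult_left_mono add_mono one ennreal_abs_triangle_powr[OF p0]) auto
    also have "\<dots> = (ennreal (2 powr p) * ennreal (2 powr p)) * (?f1 x + (?f2 x + ?f3 x))"
      by (simp only: distrib_left mult.assoc)
    also have "ennreal (2 powr p) * ennreal (2 powr p) = ennreal (4 powr p)"
      by (simp add: ennreal_mult'[symmetric] powr_mult[symmetric])
    finally show ?thesis .
  qed
  then have "(\<integral>\<^sup>+ x. ennreal (\<bar>u (x, t) - v x\<bar> powr p) \<partial>lborel)
      \<le> (\<integral>\<^sup>+ x. ennreal (4 powr p) * (?f1 x + (?f2 x + ?f3 x)) \<partial>lborel)"
    by (rule nn_integral_mono)
  also have "\<dots> = ennreal (4 powr p) * ((\<integral>\<^sup>+ x. ?f1 x \<partial>lborel) + ((\<integral>\<^sup>+ x. ?f2 x \<partial>lborel) + (\<integral>\<^sup>+ x. ?f3 x \<partial>lborel)))"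
    by (simp add: nn_integral_cmult nn_integral_add)
  also have "\<dots> \<le> ennreal (4 powr p)
      * (ennreal (rate * ?q) * energy + (ennreal (?K * ?q) * energy + ennreal (rate * ?q) * energy))"
    by (intro mult_left_mono add_mono i1 i2 i3) auto
  also have "\<dots> = ennreal (4 powr p) * (ennreal (rate * ?q + (?K * ?q + rate * ?q)) * energy)"
  proof -
    have "rate * ?q \<ge> 0" "?K * ?q \<ge> 0" using rate V_pos by auto
    then show ?thesis by (simp only: ennreal_plus add_nonneg_nonneg distrib_right)
  qed
  also have "\<dots> = ennreal (4 powr p * (rate * ?q + (?K * ?q + rate * ?q))) * energy"
    by (simp only: mult.assoc[symmetric], subst ennreal_mult') auto
  also have "4 powr p * (rate * ?q + (?K * ?q + rate * ?q)) = 4 powr p * (2 * rate + ?K) * ?q"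
    by (simp only: distrib_left distrib_right mult_2 mult.assoc add_ac)
  finally show ?thesis .
qed

end

section \<open>The trace inequality\<close>

definition tail_const :: "nat \<Rightarrow> real \<Rightarrow> real" where
  "tail_const n g = unit_ball_vol n * 2 ^ n / (1 - 2 powr - g)"

context sobolev_fun
begin

abbreviation \<beta> :: real where "\<beta> \<equiv> \<alpha> - 1"

lemma tail_const_nonneg: "tail_const n \<alpha> \<ge> 0"
  using \<alpha>_pos unfolding tail_const_def by (intro divide_nonneg_pos) (auto simp: powr_less_one)

text \<open>
  If \<open>b\<close> lies in the cylinder on \<open>(x, 0)\<close> whose size is comparable to \<open>n = |a - (x, 0)|\<close>, then
  \<open>|a - b| \<le> 5n\<close>. So the kernel in \<open>(a, b)\<close> is an integral over \<open>x\<close> of \<open>n\<^bsup>-(d + \<alpha>)\<^esup>\<close> with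
  \<open>n \<ge> max |x - a'| (|a - b| / 5)\<close>, where \<open>a'\<close> is the projection of \<open>a\<close>: a tail in dimension \<open>d\<close>.
\<close>

lemma point_average_integral_le:
  "(\<integral>\<^sup>+ x. \<integral>\<^sup>+ y. ennreal (norm (y - (x, 0)) powr - \<beta>)
      * (indicator H y * ennreal (\<bar>u y - avg (dyadic (norm (y - (x, 0)))) (x, 0)\<bar> powr p)) \<partial>lborel \<partial>lborel)
    \<le> ennreal (tail_const DIM('a) \<alpha> * 5 powr \<alpha> / V) * energy"
proof -
  let ?r = "\<lambda>x (y :: 'a \<times> real). dyadic (norm (y - (x, 0)))"
  let ?k = "\<lambda>x c. ennreal (norm (fst c - (x, 0)) powr - \<beta>)
      * (ennreal (1 / vol (?r x (fst c))) * indicator (cyl (x, 0) (?r x (fst c))) (snd c))"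
  have [measurable]: "vol \<in> borel_measurable borel" unfolding vol_def[abs_def] by measurable
  have "(\<integral>\<^sup>+ x. \<integral>\<^sup>+ y. ennreal (norm (y - (x, 0)) powr - \<beta>)
      * (indicator H y * ennreal (\<bar>u y - avg (?r x y) (x, 0)\<bar> powr p)) \<partial>lborel \<partial>lborel)
    \<le> (\<integral>\<^sup>+ x. \<integral>\<^sup>+ y. (\<integral>\<^sup>+ b. ?k x (y, b) * diff_pow (y, b) \<partial>lborel) \<partial>lborel \<partial>lborel)"
  proof (intro nn_integral_mono)
    fix x y
    have "indicator H y * ennreal (\<bar>u y - avg (?r x y) (x, 0)\<bar> powr p)
        \<le> ennreal (1 / vol (?r x y)) * (\<integral>\<^sup>+ b. indicator (cyl (x, 0) (?r x y)) b * diff_pow (y, b) \<partial>lborel)"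
      using average_point_le[of "?r x y" "(x, 0)" y] by (cases "y \<in> H") auto
    then have "ennreal (norm (y - (x, 0)) powr - \<beta>) * (indicator H y * ennreal (\<bar>u y - avg (?r x y) (x, 0)\<bar> powr p))
       \<le> ennreal (norm (y - (x, 0)) powr - \<beta>)
           * (ennreal (1 / vol (?r x y)) * (\<integral>\<^sup>+ b. indicator (cyl (x, 0) (?r x y)) b * diff_pow (y, b) \<partial>lborel))"
      by (rule mult_left_mono) simp
    also have "\<dots> = (\<integral>\<^sup>+ b. ?k x (y, b) * diff_pow (y, b) \<partial>lborel)"
      by (simp add: mult.assoc nn_integral_cmult)
    finally show "ennreal (norm (y - (x, 0)) powr - \<beta>)
        * (indicator H y * ennreal (\<bar>u y - avg (?r x y) (x, 0)\<bar> powr p)) \<le> \<dots>" .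
  qed
  also have "\<dots> = (\<integral>\<^sup>+ x. \<integral>\<^sup>+ c. ?k x c * diff_pow c \<partial>lborel \<partial>lborel)"
    by (intro nn_integral_cong, subst nn_integral_lborel_pair) auto
  also have "\<dots> = (\<integral>\<^sup>+ c. \<integral>\<^sup>+ x. ?k x c * diff_pow c \<partial>lborel \<partial>lborel)"
    by (rule nn_integral_lborel_swap) measurable
  also have "\<dots> = (\<integral>\<^sup>+ c. (\<integral>\<^sup>+ x. ?k x c \<partial>lborel) * diff_pow c \<partial>lborel)"
    by (intro nn_integral_cong nn_integral_multc) measurable
  also have "\<dots> \<le> ennreal (tail_const DIM('a) \<alpha> * 5 powr \<alpha> / V) * energy"
  proof (rule kernel_le)
    fix a b :: "'a \<times> real" assume a: "a \<in> H" and ne: "a \<noteq> b"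
    define \<rho> where "\<rho> = norm (a - b) / 5"
    have \<rho>: "\<rho> > 0" using ne by (simp add: \<rho>_def)
    have "?k x (a, b) \<le> ennreal (1 / V) * ennreal (max (norm (x - fst a)) \<rho> powr - (real DIM('a) + \<alpha>))" for x
    proof (cases "b \<in> cyl (x, 0) (?r x a)")
      case True
      define n where "n = norm (a - (x, 0))"
      \<comment> \<open>The point \<open>a\<close> lies in the open half space, so it differs from \<open>(x, 0)\<close>.\<close>
      have n: "n > 0" using a by (auto simp: n_def)
      have "norm (b - (x, 0)) \<le> norm (fst b - x) + norm (snd b)"
        using norm_Pair_le[of "fst b - x" "snd b"] by (cases b) simp
      also have "\<dots> \<le> 2 * dyadic n" using True by (auto simp: in_cyl n_def)
      also have "\<dots> \<le> 4 * n" using dyadic_bounds[OF n] by simp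
      finally have "norm (a - b) \<le> 5 * n"
        using norm_triangle_ineq4[of "a - (x, 0)" "b - (x, 0)"] unfolding n_def by simp
      moreover have "norm (x - fst a) \<le> n"
        using norm_fst_le[of "fst a - x" "snd a"] by (cases a) (simp add: n_def norm_minus_commute)
      ultimately have mx: "max (norm (x - fst a)) \<rho> \<le> n" by (simp add: \<rho>_def)
      have "n powr - \<beta> * (1 / vol (dyadic n)) \<le> n powr - \<beta> * (1 / (V * n ^ Suc DIM('a)))"
        using n V_pos dyadic_bounds[OF n] unfolding vol_def
        by (intro mult_left_mono divide_left_mono power_mono mult_pos_pos zero_less_power) auto
      also have "\<dots> = 1 / V * n powr - (real DIM('a) + \<alpha>)"
      proof -
        have "n powr - (real DIM('a) + \<alpha>) = n powr - \<beta> * n powr - real (Suc DIM('a))"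
          by (simp add: powr_add[symmetric] algebra_simps)
        also have "n powr - real (Suc DIM('a)) = 1 / n ^ Suc DIM('a)"
          using n by (simp only: powr_minus_divide powr_realpow)
        finally show ?thesis by simp
      qed
      also have "\<dots> \<le> 1 / V * max (norm (x - fst a)) \<rho> powr - (real DIM('a) + \<alpha>)"
        using mx \<rho> V_pos \<alpha>_pos by (intro mult_left_mono powr_mono2') auto
      finally show ?thesis using True V_pos
        by (simp add: n_def[symmetric] ennreal_mult'[symmetric] ennreal_leI)
    qed simp
    then have "(\<integral>\<^sup>+ x. ?k x (a, b) \<partial>lborel)
        \<le> (\<integral>\<^sup>+ x. ennreal (1 / V) * ennreal (max (norm (x - fst a)) \<rho> powr - (real DIM('a) + \<alpha>)) \<partial>lborel)"
      by (rule nn_integral_mono)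
    also have "\<dots> = ennreal (1 / V) * (\<integral>\<^sup>+ x. ennreal (max (norm (x - fst a)) \<rho> powr - (real DIM('a) + \<alpha>)) \<partial>lborel)"
      by (rule nn_integral_cmult) measurable
    also have "\<dots> \<le> ennreal (1 / V) * ennreal (tail_const DIM('a) \<alpha> * \<rho> powr - \<alpha>)"
      unfolding tail_const_def by (intro mult_left_mono nn_integral_tail \<rho> \<alpha>_pos) auto
    also have "\<dots> = ennreal (1 / V * (tail_const DIM('a) \<alpha> * \<rho> powr - \<alpha>))"
      using V_pos by (intro ennreal_mult'[symmetric]) auto
    also have "1 / V * (tail_const DIM('a) \<alpha> * \<rho> powr - \<alpha>)
        = tail_const DIM('a) \<alpha> * 5 powr \<alpha> / V * norm (a - b) powr - \<alpha>"
      by (simp add: \<rho>_def powr_divide powr_minus_divide)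
    finally show "(\<integral>\<^sup>+ x. ?k x (a, b) \<partial>lborel)
        \<le> ennreal (tail_const DIM('a) \<alpha> * 5 powr \<alpha> / V * norm (a - b) powr - \<alpha>)" .
  qed (use V_pos tail_const_nonneg in auto)
  finally show ?thesis .
qed

text \<open>
  A pair \<open>(a, b)\<close> is seen only by those \<open>z\<close> with \<open>|z| \<ge> |a - b| / (6h)\<close>, so the kernel is a tail in
  dimension \<open>d + 1\<close>. The factor \<open>h\<^bsup>sp - 1\<^esup>\<close> is what makes the sum over the scales \<open>h = 2\<^sup>-\<^sup>k\<close> converge.
\<close>

lemma near_energy_integral_le:
  assumes h: "h > 0"
  shows "(\<integral>\<^sup>+ z. ennreal (norm (z :: 'a \<times> real) powr - \<beta>) * near_energy (dyadic (norm z) * h) \<partial>lborel)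
    \<le> ennreal (tail_const (Suc DIM('a)) \<alpha> * 6 powr \<alpha> / V * h powr (s * p - 1)) * energy"
proof -
  let ?r = "\<lambda>z :: 'a \<times> real. dyadic (norm z) * h"
  let ?k = "\<lambda>z c. ennreal (norm z powr - \<beta>)
      * (ennreal (1 / (V * ?r z ^ (DIM('a) + 2))) * indicator {c. norm (fst c - snd c) \<le> 3 * ?r z} c)"
  have "(\<integral>\<^sup>+ z. ennreal (norm (z :: 'a \<times> real) powr - \<beta>) * near_energy (?r z) \<partial>lborel)
      = (\<integral>\<^sup>+ z. \<integral>\<^sup>+ c. ?k z c * diff_pow c \<partial>lborel \<partial>lborel)"
    unfolding near_energy_def by (simp add: mult.assoc nn_integral_cmult)
  also have "\<dots> = (\<integral>\<^sup>+ c. \<integral>\<^sup>+ z. ?k z c * diff_pow c \<partial>lborel \<partial>lborel)"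
    by (rule nn_integral_lborel_swap) (simp add: indicator_def)
  also have "\<dots> = (\<integral>\<^sup>+ c. (\<integral>\<^sup>+ z. ?k z c \<partial>lborel) * diff_pow c \<partial>lborel)"
    by (intro nn_integral_cong nn_integral_multc) (simp add: indicator_def)
  also have "\<dots> \<le> ennreal (tail_const (Suc DIM('a)) \<alpha> * 6 powr \<alpha> / V * h powr (s * p - 1)) * energy"
  proof (rule kernel_le)
    fix a b :: "'a \<times> real" assume ne: "a \<noteq> b"
    \<comment> \<open>The near pairs satisfy \<open>|a - b| \<le> 3h dyadic(|z|) \<le> 6h|z|\<close>.\<close>
    define \<rho> where "\<rho> = norm (a - b) / (6 * h)"
    have \<rho>: "\<rho> > 0" using ne h by (simp add: \<rho>_def)
    define c where "c = 1 / (V * h ^ (DIM('a) + 2))"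
    have c: "c \<ge> 0" using V_pos h by (simp add: c_def)
    have "?k z (a, b) \<le> ennreal c * ennreal (max (norm (z - 0)) \<rho> powr - (real DIM('a \<times> real) + \<alpha>))" for z
    proof (cases "z \<noteq> 0 \<and> norm (a - b) \<le> 3 * ?r z")
      case True
      define n where "n = norm z"
      have n: "n > 0" using True by (auto simp: n_def)
      have "norm (a - b) \<le> 3 * dyadic n * h" using True by (simp add: n_def)
      also have "\<dots> \<le> 6 * n * h" using dyadic_bounds[OF n] h by (intro mult_right_mono) auto
      finally have mx: "max n \<rho> \<le> n" using h by (simp add: \<rho>_def divide_simps mult_ac)
      have "n powr - \<beta> * (1 / (V * (dyadic n * h) ^ (DIM('a) + 2)))
          \<le> n powr - \<beta> * (1 / (V * (n * h) ^ (DIM('a) + 2)))"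
        using n V_pos h dyadic_bounds[OF n]
        by (intro mult_left_mono divide_left_mono power_mono mult_right_mono mult_pos_pos zero_less_power) auto
      also have "\<dots> = c * n powr - (real DIM('a \<times> real) + \<alpha>)"
      proof -
        have "n powr - (real DIM('a \<times> real) + \<alpha>) = n powr - \<beta> * n powr - real (DIM('a) + 2)"
          by (simp add: powr_add[symmetric] algebra_simps)
        also have "n powr - real (DIM('a) + 2) = 1 / n ^ (DIM('a) + 2)"
          using n by (simp only: powr_minus_divide powr_realpow)
        finally show ?thesis by (simp add: c_def power_mult_distrib)
      qed
      also have "\<dots> \<le> c * max n \<rho> powr - (real DIM('a \<times> real) + \<alpha>)"
        using mx \<rho> c \<alpha>_pos n by (intro mult_left_mono powr_mono2') auto
      finally show ?thesis using True c
        by (simp add: n_def[symmetric] ennreal_mult'[symmetric] ennreal_leI)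
    qed auto
    then have "(\<integral>\<^sup>+ z. ?k z (a, b) \<partial>lborel)
        \<le> (\<integral>\<^sup>+ z. ennreal c
        * ennreal (max (norm (z - (0 :: 'a \<times> real))) \<rho> powr - (real DIM('a \<times> real) + \<alpha>)) \<partial>lborel)"
      by (rule nn_integral_mono)
    also have "\<dots> = ennreal c
        * (\<integral>\<^sup>+ z. ennreal (max (norm (z - (0 :: 'a \<times> real))) \<rho> powr - (real DIM('a \<times> real) + \<alpha>)) \<partial>lborel)"
      by (rule nn_integral_cmult) measurable
    also have "\<dots> \<le> ennreal c * ennreal (tail_const (DIM('a \<times> real)) \<alpha> * \<rho> powr - \<alpha>)"
      unfolding tail_const_def by (intro mult_left_mono nn_integral_tail \<rho> \<alpha>_pos) auto
    also have "\<dots> = ennreal (c * (tail_const (Suc DIM('a)) \<alpha> * \<rho> powr - \<alpha>))"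
      using c by (subst ennreal_mult'[symmetric]) auto
    also have "c * (tail_const (Suc DIM('a)) \<alpha> * \<rho> powr - \<alpha>)
        = tail_const (Suc DIM('a)) \<alpha> * 6 powr \<alpha> / V * h powr (s * p - 1) * norm (a - b) powr - \<alpha>"
    proof -
      have "h powr \<alpha> = h powr (s * p - 1) * h powr real (DIM('a) + 2)"
        by (simp add: powr_add[symmetric] \<alpha>_def add_ac)
      also have "h powr real (DIM('a) + 2) = h ^ (DIM('a) + 2)" using h by (rule powr_realpow)
      finally have h\<alpha>: "h powr \<alpha> = h powr (s * p - 1) * h ^ (DIM('a) + 2)" .
      have "\<rho> powr - \<alpha> = 6 powr \<alpha> * h powr \<alpha> * norm (a - b) powr - \<alpha>"
        using h by (simp add: \<rho>_def powr_divide powr_minus_divide powr_mult)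
      then have "c * (tail_const (Suc DIM('a)) \<alpha> * \<rho> powr - \<alpha>)
        = tail_const (Suc DIM('a)) \<alpha> * 6 powr \<alpha> * norm (a - b) powr - \<alpha> * (h powr \<alpha> * c)" by (simp only: mult_ac)
      also have "h powr \<alpha> * c = h powr (s * p - 1) / V" using h by (simp add: h\<alpha> c_def)
      finally show ?thesis by simp
    qed
    finally show "(\<integral>\<^sup>+ z. ?k z (a, b) \<partial>lborel)
        \<le> ennreal (tail_const (Suc DIM('a)) \<alpha> * 6 powr \<alpha> / V * h powr (s * p - 1) * norm (a - b) powr - \<alpha>)" .
  qed (use V_pos tail_const_nonneg in auto)
  finally show ?thesis .
qed

text \<open>
  After translation by \<open>(x, 0)\<close> the weight depends on \<open>z = y - (x, 0)\<close> only, so that the integral over \<open>x\<close>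
  falls on the oscillations alone, for which it is bounded by the energy of the near pairs.
\<close>

lemma osc_series_integral_le:
  "(\<integral>\<^sup>+ x. \<integral>\<^sup>+ y. ennreal (norm ((y :: 'a \<times> real) - (x, 0)) powr - \<beta>)
      * osc_series (x, 0) (dyadic (norm (y - (x, 0)))) \<partial>lborel \<partial>lborel)
    \<le> ennreal (tail_const (Suc DIM('a)) \<alpha> * 6 powr \<alpha> / V / (1 - 2 powr - \<epsilon>)) * energy"
proof -
  let ?I = "\<lambda>k. \<integral>\<^sup>+ z. ennreal (norm (z :: 'a \<times> real) powr - \<beta>)
      * (\<integral>\<^sup>+ x. osc (x, 0) (dyadic (norm z) / 2 ^ k) \<partial>lborel) \<partial>lborel"
  have "(\<integral>\<^sup>+ x. \<integral>\<^sup>+ y. ennreal (norm ((y :: 'a \<times> real) - (x, 0)) powr - \<beta>)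
      * osc_series (x, 0) (dyadic (norm (y - (x, 0)))) \<partial>lborel \<partial>lborel)
    = (\<integral>\<^sup>+ x. \<integral>\<^sup>+ z. ennreal (norm (z :: 'a \<times> real) powr - \<beta>)
        * osc_series (x, 0) (dyadic (norm z)) \<partial>lborel \<partial>lborel)"
  proof (rule nn_integral_cong)
    fix x :: 'a
    show "(\<integral>\<^sup>+ y. ennreal (norm ((y :: 'a \<times> real) - (x, 0)) powr - \<beta>)
        * osc_series (x, 0) (dyadic (norm (y - (x, 0)))) \<partial>lborel)
      = (\<integral>\<^sup>+ z. ennreal (norm (z :: 'a \<times> real) powr - \<beta>) * osc_series (x, 0) (dyadic (norm z)) \<partial>lborel)"
      using nn_integral_lborel_translate[of "\<lambda>z :: 'a \<times> real. ennreal (norm z powr - \<beta>)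
          * osc_series (x, 0) (dyadic (norm z))" "- (x, 0)"]
      by (simp del: uminus_Pair)
  qed
  also have "\<dots> = (\<integral>\<^sup>+ z. \<integral>\<^sup>+ x. ennreal (norm (z :: 'a \<times> real) powr - \<beta>)
      * osc_series (x, 0) (dyadic (norm z)) \<partial>lborel \<partial>lborel)"
    by (rule nn_integral_lborel_swap) measurable
  also have "\<dots> = (\<integral>\<^sup>+ z. ennreal (norm (z :: 'a \<times> real) powr - \<beta>)
      * (\<Sum>k. ennreal (2 powr (real k * \<epsilon>)) * (\<integral>\<^sup>+ x. osc (x, 0) (dyadic (norm z) / 2 ^ k) \<partial>lborel)) \<partial>lborel)"
    unfolding osc_series_def by (simp add: nn_integral_cmult nn_integral_suminf)
  also have "\<dots> = (\<integral>\<^sup>+ z. (\<Sum>k. ennreal (2 powr (real k * \<epsilon>))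
      * (ennreal (norm (z :: 'a \<times> real) powr - \<beta>)
      * (\<integral>\<^sup>+ x. osc (x, 0) (dyadic (norm z) / 2 ^ k) \<partial>lborel))) \<partial>lborel)"
    by (simp only: ennreal_suminf_cmult[symmetric] mult.left_commute)
  also have "\<dots> = (\<Sum>k. ennreal (2 powr (real k * \<epsilon>)) * ?I k)"
    by (simp add: nn_integral_cmult nn_integral_suminf)
  also have "\<dots> \<le> (\<Sum>k. ennreal (tail_const (Suc DIM('a)) \<alpha> * 6 powr \<alpha> / V * 2 powr - (real k * \<epsilon>)) * energy)"
  proof (intro suminf_le summableI)
    fix k
    have "?I k \<le> (\<integral>\<^sup>+ z. ennreal (norm (z :: 'a \<times> real) powr - \<beta>)
        * near_energy (dyadic (norm z) * (1 / 2 ^ k)) \<partial>lborel)"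
      using integral_osc_le by (intro nn_integral_mono mult_left_mono) auto
    also have "\<dots> \<le> ennreal (tail_const (Suc DIM('a)) \<alpha> * 6 powr \<alpha> / V * (1 / 2 ^ k) powr (s * p - 1)) * energy"
      by (rule near_energy_integral_le) simp
    finally have "ennreal (2 powr (real k * \<epsilon>)) * ?I k
        \<le> ennreal (2 powr (real k * \<epsilon>))
        * (ennreal (tail_const (Suc DIM('a)) \<alpha> * 6 powr \<alpha> / V * (1 / 2 ^ k) powr (s * p - 1)) * energy)"
      by (rule mult_left_mono) simp
    also have "\<dots> = ennreal (2 powr (real k * \<epsilon>)
        * (tail_const (Suc DIM('a)) \<alpha> * 6 powr \<alpha> / V * (1 / 2 ^ k) powr (s * p - 1))) * energy"
      by (rule ennreal_mult_fold) simp
    also have "2 powr (real k * \<epsilon>) * (tail_const (Suc DIM('a)) \<alpha> * 6 powr \<alpha> / V * (1 / 2 ^ k) powr (s * p - 1))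
       = tail_const (Suc DIM('a)) \<alpha> * 6 powr \<alpha> / V * 2 powr - (real k * \<epsilon>)"
    proof -
      have "(1 / 2 ^ k) powr (s * p - 1) = 2 powr - (real k * (2 * \<epsilon>))"
      proof -
        have "2 * \<epsilon> = s * p - 1" by (simp add: \<epsilon>_def)
        then show ?thesis
          by (simp add: powr_divide powr_realpow[symmetric] powr_powr powr_minus_divide)
      qed
      moreover have "2 powr (real k * \<epsilon>) * 2 powr - (real k * (2 * \<epsilon>)) = 2 powr - (real k * \<epsilon>)"
        by (simp add: powr_add[symmetric])
      ultimately show ?thesis by (simp add: ac_simps)
    qed
    finally show "ennreal (2 powr (real k * \<epsilon>)) * ?I k
        \<le> ennreal (tail_const (Suc DIM('a)) \<alpha> * 6 powr \<alpha> / V * 2 powr - (real k * \<epsilon>)) * energy" .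
  qed
  also have "\<dots> = (\<Sum>k. ennreal (tail_const (Suc DIM('a)) \<alpha> * 6 powr \<alpha> / V * 2 powr - (real k * \<epsilon>))) * energy"
    by (rule ennreal_suminf_multc)
  also have "\<dots> = ennreal (tail_const (Suc DIM('a)) \<alpha> * 6 powr \<alpha> / V / (1 - 2 powr - \<epsilon>)) * energy"
    using V_pos tail_const_nonneg by (subst suminf_geometric_weight[OF \<epsilon>_pos]) auto
  finally show ?thesis .
qed

definition main_const :: real where
  "main_const = 2 powr p * (tail_const DIM('a) \<alpha> * 5 powr \<alpha> / V
     + telescope_const \<epsilon> p * 2 ^ Suc DIM('a) * (tail_const (Suc DIM('a)) \<alpha> * 6 powr \<alpha> / V / (1 - 2 powr - \<epsilon>)))"

text \<open>
  The intermediate value between \<open>u(y)\<close> and \<open>v(x)\<close> is the average over the cylinder on \<open>(x, 0)\<close> of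
  dyadic size comparable to the distance from \<open>y\<close> to \<open>(x, 0)\<close>.
\<close>

lemma trace_integral_le:
  "(\<integral>\<^sup>+ x. \<integral>\<^sup>+ y. indicator H y * ennreal (\<bar>v x - u y\<bar> powr p / norm ((x, 0) - y) powr \<beta>) \<partial>lborel \<partial>lborel)
    \<le> ennreal main_const * energy"
proof -
  let ?K = "telescope_const \<epsilon> p * 2 ^ Suc DIM('a)"
  let ?A = "\<lambda>x (y :: 'a \<times> real). ennreal (norm (y - (x, 0)) powr - \<beta>)
      * (indicator H y * ennreal (\<bar>u y - avg (dyadic (norm (y - (x, 0)))) (x, 0)\<bar> powr p))"
  let ?B = "\<lambda>x (y :: 'a \<times> real). ennreal (norm (y - (x, 0)) powr - \<beta>)
      * osc_series (x, 0) (dyadic (norm (y - (x, 0))))"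
  have K: "?K \<ge> 0" by (simp add: telescope_const_def)
  have "(\<integral>\<^sup>+ x. \<integral>\<^sup>+ y. indicator H y * ennreal (\<bar>v x - u y\<bar> powr p / norm ((x, 0) - y) powr \<beta>) \<partial>lborel \<partial>lborel)
     \<le> (\<integral>\<^sup>+ x. \<integral>\<^sup>+ y. ennreal (2 powr p) * (?A x y + ennreal ?K * ?B x y) \<partial>lborel \<partial>lborel)"
    using avg_tendsto_v
  proof (intro nn_integral_mono_AE, eventually_elim, intro nn_integral_mono)
    fix x :: 'a and y :: "'a \<times> real" assume l: "(\<lambda>k. avg (1 / 2 ^ k) (x, 0)) \<longlonglongrightarrow> v x"
    let ?r = "dyadic (norm (y - (x, 0)))" and ?w = "ennreal (norm (y - (x, 0)) powr - \<beta>)"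
    have 1: "ennreal (\<bar>avg ?r (x, 0) - v x\<bar> powr p) \<le> ennreal ?K * osc_series (x, 0) ?r"
      by (rule osc_series_telescope(2)) (auto intro: dyadic_subsequence l)
    have "indicator H y * ennreal (\<bar>v x - u y\<bar> powr p / norm ((x, 0) - y) powr \<beta>)
        = ?w * (indicator H y * ennreal (\<bar>u y - v x\<bar> powr p))"
      by (simp add: powr_minus_divide[of _ \<beta>] ennreal_mult'[symmetric] norm_minus_commute abs_minus_commute
        indicator_def del: minus_diff_eq)
    also have "\<dots> \<le> ?w
        * (indicator H y * (ennreal (2 powr p)
        * (ennreal (\<bar>u y - avg ?r (x, 0)\<bar> powr p) + ennreal (\<bar>avg ?r (x, 0) - v x\<bar> powr p))))"
      using p_ge by (intro mult_left_mono ennreal_abs_triangle_powr) auto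
    also have "\<dots> \<le> ?w
        * (ennreal (2 powr p) * (indicator H y * ennreal (\<bar>u y - avg ?r (x, 0)\<bar> powr p) + ennreal ?K
        * osc_series (x, 0) ?r))"
      using 1 by (intro mult_left_mono) (auto simp: indicator_def intro!: mult_left_mono add_left_mono)
    also have "\<dots> = ennreal (2 powr p) * (?A x y + ennreal ?K * ?B x y)"
      by (simp only: distrib_left mult_ac)
    finally show "indicator H y * ennreal (\<bar>v x - u y\<bar> powr p / norm ((x, 0) - y) powr \<beta>) \<le> \<dots>" .
  qed
  also have "\<dots> = ennreal (2 powr p)
      * ((\<integral>\<^sup>+ x. \<integral>\<^sup>+ y. ?A x y \<partial>lborel \<partial>lborel) + ennreal ?K * (\<integral>\<^sup>+ x. \<integral>\<^sup>+ y. ?B x y \<partial>lborel \<partial>lborel))"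
    by (simp add: nn_integral_cmult nn_integral_add del: power_Suc)
  also have "\<dots> \<le> ennreal (2 powr p) * (ennreal (tail_const DIM('a) \<alpha> * 5 powr \<alpha> / V) * energy
      + ennreal ?K * (ennreal (tail_const (Suc DIM('a)) \<alpha> * 6 powr \<alpha> / V / (1 - 2 powr - \<epsilon>)) * energy))"
    by (intro mult_left_mono add_mono point_average_integral_le osc_series_integral_le) auto
  also have "\<dots> = ennreal main_const * energy"
  proof -
    have "tail_const (Suc DIM('a)) \<alpha> * 6 powr \<alpha> / V / (1 - 2 powr - \<epsilon>) \<ge> 0"
      using tail_const_nonneg V_pos \<epsilon>_pos by (intro divide_nonneg_pos) (auto simp: powr_less_one)
    moreover have "tail_const DIM('a) \<alpha> * 5 powr \<alpha> / V \<ge> 0"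
      using tail_const_nonneg V_pos by auto
    ultimately show ?thesis using K unfolding main_const_def
      by (simp only: ennreal_mult_fold distrib_right[symmetric] ennreal_plus[symmetric] mult_nonneg_nonneg powr_ge_zero)
  qed
  finally show ?thesis .
qed

end

section \<open>Local integrability and convergence of the slices\<close>

text \<open>
  Pointwise, \<open>a \<le> \<delta> + \<delta>\<^bsup>1 - p\<^esup> a\<^sup>p\<close>: one of the two terms dominates according to whether \<open>a \<le> \<delta>\<close>. With
  \<open>\<delta> = 1\<close> this yields local integrability; with \<open>\<delta>\<close> tending to zero, it turns convergence in \<open>L\<^sup>p\<close>
  into convergence in \<open>L\<^sup>1\<close> on sets of finite measure.
\<close>

lemma integral_compact_le_powr:
  fixes f :: "'b::euclidean_space \<Rightarrow> real" and \<delta> p :: real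
  assumes [measurable]: "f \<in> borel_measurable borel" "K \<in> sets borel" and \<delta>: "\<delta> > 0" and p: "p \<ge> 1"
  shows "(\<integral>\<^sup>+ x. indicator K x * ennreal \<bar>f x\<bar> \<partial>lborel)
    \<le> ennreal \<delta> * emeasure lborel K + ennreal (\<delta> powr (1 - p)) * (\<integral>\<^sup>+ x. ennreal (\<bar>f x\<bar> powr p) \<partial>lborel)"
proof -
  have "a \<le> \<delta> + \<delta> powr (1 - p) * a powr p" if "a \<ge> 0" for a :: real
  proof (cases "a \<le> \<delta>")
    case False
    have "1 \<le> (a / \<delta>) powr (p - 1)" using False \<delta> p by (intro ge_one_powr_ge_zero) auto
    also have "\<dots> = a powr (p - 1) * \<delta> powr (1 - p)"
      using False \<delta> by (simp add: powr_divide powr_diff field_simps)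
    finally have "a * 1 \<le> a * (a powr (p - 1) * \<delta> powr (1 - p))" using that by (rule mult_left_mono)
    also have "a * (a powr (p - 1) * \<delta> powr (1 - p)) = \<delta> powr (1 - p) * a powr p"
      using False \<delta> by (simp add: powr_diff)
    finally show ?thesis using \<delta> by simp
  next
    case True
    moreover have "0 \<le> \<delta> powr (1 - p) * a powr p" by simp
    ultimately show ?thesis by linarith
  qed
  note le = this
  have "indicator K x * ennreal \<bar>f x\<bar>
      \<le> ennreal \<delta> * indicator K x + ennreal (\<delta> powr (1 - p)) * ennreal (\<bar>f x\<bar> powr p)" for x
  proof (cases "x \<in> K")
    case True
    have "ennreal \<bar>f x\<bar> \<le> ennreal (\<delta> + \<delta> powr (1 - p) * \<bar>f x\<bar> powr p)" by (intro ennreal_leI le) simp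
    also have "\<dots> = ennreal \<delta> + ennreal (\<delta> powr (1 - p)) * ennreal (\<bar>f x\<bar> powr p)"
      using \<delta> by (simp add: ennreal_mult')
    finally show ?thesis using True by simp
  qed simp
  then have "(\<integral>\<^sup>+ x. indicator K x * ennreal \<bar>f x\<bar> \<partial>lborel)
    \<le> (\<integral>\<^sup>+ x. ennreal \<delta> * indicator K x + ennreal (\<delta> powr (1 - p)) * ennreal (\<bar>f x\<bar> powr p) \<partial>lborel)"
    by (rule nn_integral_mono)
  also have "\<dots> = ennreal \<delta> * emeasure lborel K + ennreal (\<delta> powr (1 - p)) * (\<integral>\<^sup>+ x. ennreal (\<bar>f x\<bar> powr p) \<partial>lborel)"
    by (simp add: nn_integral_add nn_integral_cmult nn_integral_cmult_indicator)
  finally show ?thesis .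
qed

lemma compact_emeasure_fin: "compact K \<Longrightarrow> emeasure lborel (K :: 'b::euclidean_space set) < \<infinity>"
  using emeasure_compact_finite by auto

lemma locally_integrable_add_Lp:
  fixes f g :: "'b::euclidean_space \<Rightarrow> real"
  assumes [measurable]: "f \<in> borel_measurable borel" "g \<in> borel_measurable borel"
    and p: "p \<ge> 1" and fin: "(\<integral>\<^sup>+ x. ennreal (\<bar>f x - g x\<bar> powr p) \<partial>lborel) < \<infinity>"
    and g: "locally_integrable g"
  shows "locally_integrable f"
  unfolding locally_integrable_def
proof (intro allI impI)
  fix K :: "'b set" assume K: "compact K"
  then have [measurable]: "K \<in> sets borel" by (simp add: borel_compact)
  have "(\<integral>\<^sup>+ x. indicator K x * ennreal \<bar>f x - g x\<bar> \<partial>lborel) < \<infinity>"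
    using integral_compact_le_powr[of "\<lambda>x. f x - g x" K 1 p] p fin compact_emeasure_fin[OF K]
    by (auto elim!: le_less_trans)
  then have "set_integrable lborel K (\<lambda>x. f x - g x)"
    unfolding set_integrable_def by (intro integrableI_bounded)
      (auto simp: abs_mult ennreal_mult' ennreal_indicator)
  then have "(\<lambda>x. f x - g x) absolutely_integrable_on K"
    unfolding set_integrable_def by (intro integrable_completion[THEN iffD2]) auto
  moreover have "g absolutely_integrable_on K" using g K by (auto simp: locally_integrable_def)
  ultimately have "(\<lambda>x. (f x - g x) + g x) absolutely_integrable_on K" by (rule set_integral_add(1))
  then show "f absolutely_integrable_on K" by simp
qed

lemma AE_lborel_fst:
  assumes "AE x in (lborel :: 'a::euclidean_space measure). P x"
  shows "AE c in (lborel :: ('a \<times> 'b::euclidean_space) measure). P (fst c)"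
proof -
  obtain N where N: "{x. \<not> P x} \<subseteq> N" "emeasure lborel N = 0" "N \<in> sets lborel"
    using AE_E[OF assms] by auto
  have "N \<times> UNIV \<in> null_sets (lborel \<Otimes>\<^sub>M lborel :: ('a \<times> 'b) measure)"
    using N(2,3) by (intro null_setsI) (auto simp: lborel.emeasure_pair_measure_Times simp del: lborel_prod)
  then show ?thesis unfolding lborel_prod by (rule AE_I') (use N(1) in auto)
qed

lemma AE_lborel_snd:
  assumes "AE x in (lborel :: 'b::euclidean_space measure). P x"
  shows "AE c in (lborel :: ('a::euclidean_space \<times> 'b) measure). P (snd c)"
proof -
  obtain N where N: "{x. \<not> P x} \<subseteq> N" "emeasure lborel N = 0" "N \<in> sets lborel"
    using AE_E[OF assms] by auto
  have "UNIV \<times> N \<in> null_sets (lborel \<Otimes>\<^sub>M lborel :: ('a \<times> 'b) measure)"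
    using N(2,3) by (intro null_setsI) (auto simp: lborel.emeasure_pair_measure_Times simp del: lborel_prod)
  then show ?thesis unfolding lborel_prod by (rule AE_I') (use N(1) in auto)
qed

context sobolev_fun
begin

text \<open>
  On a bounded set of base points, the cylinders of size \<open>r\<close> lie in one large cylinder, so the averages are
  bounded.
\<close>

lemma locally_integrable_averages:
  assumes r: "r > 0"
  shows "locally_integrable (\<lambda>x. avg r (x, 0))"
  unfolding locally_integrable_def
proof (intro allI impI)
  fix K :: "'a set" assume K: "compact K"
  then obtain b where b: "\<And>x. x \<in> K \<Longrightarrow> norm x \<le> b" "b > 0"
    using compact_imp_bounded bounded_pos by metis
  let ?Q = "cyl (0 :: 'a, 0) (b + r)"
  define M where "M = (LINT a:?Q|lborel. \<bar>u a\<bar>) / vol r"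
  have big: "set_integrable lborel ?Q (\<lambda>a. \<bar>u a\<bar>)"
    using b r by (intro set_integrable_abs integrable_cyl) auto
  have bound: "\<bar>avg r (x, 0)\<bar> \<le> M" if x: "x \<in> K" for x
  proof -
    have sub: "cyl (x, 0) r \<subseteq> ?Q"
    proof
      fix a assume a: "a \<in> cyl (x, 0) r"
      have "norm (fst a) \<le> norm (fst a - x) + norm x" using norm_triangle_ineq[of "fst a - x" x] by simp
      then show "a \<in> ?Q" using a b(1)[OF x] b(2) by (auto simp: in_cyl)
    qed
    have "\<bar>LINT a:cyl (x, 0) r|lborel. u a\<bar> \<le> (LINT a:cyl (x, 0) r|lborel. \<bar>u a\<bar>)"
      unfolding set_lebesgue_integral_def
      by (rule order_trans[OF integral_abs_bound]) (simp add: abs_mult)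
    also have "\<dots> \<le> (LINT a:?Q|lborel. \<bar>u a\<bar>)"
      unfolding set_lebesgue_integral_def
      using big set_integrable_abs[OF integrable_cyl[OF r, of "(x, 0)"]] sub unfolding set_integrable_def
      by (intro integral_mono) (auto simp: indicator_def)
    finally show ?thesis using vol_pos[OF r] by (simp add: avg_def M_def divide_right_mono)
  qed
  have [measurable]: "K \<in> sets borel" using K by (simp add: borel_compact)
  have "set_integrable lborel K (\<lambda>x. avg r (x, 0))"
    unfolding set_integrable_def
  proof (rule integrableI_bounded_set[where A = K and B = M])
    show "AE x in lborel. x \<in> K \<longrightarrow> norm (indicat_real K x *\<^sub>R avg r (x, 0)) \<le> M" using bound by auto
  qed (use compact_emeasure_fin[OF K] in auto)
  then show "(\<lambda>x. avg r (x, 0)) absolutely_integrable_on K"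
    unfolding set_integrable_def by (intro integrable_completion[THEN iffD2]) auto
qed

text \<open>
  The averages at scale \<open>1\<close> are locally integrable and differ from \<open>v\<close> by a function in \<open>L\<^sup>p\<close>.
\<close>

lemma locally_integrable_v: "locally_integrable v"
proof (rule locally_integrable_add_Lp[OF _ _ p_ge _ locally_integrable_averages])
  show "(\<integral>\<^sup>+ x. ennreal (\<bar>v x - avg (dyadic 1) (x, 0)\<bar> powr p) \<partial>lborel) < \<infinity>"
    using integral_average_limit_le[OF _ avg_tendsto_v, of 1] energy_fin
    by (auto simp: abs_minus_commute ennreal_mult_less_top elim!: le_less_trans)
qed auto

definition regular_slice :: "real \<Rightarrow> bool" where
  "regular_slice t \<longleftrightarrow> (AE x in lborel. (\<lambda>k. avg (1 / 2 ^ k) (x, t)) \<longlonglongrightarrow> u (x, t))"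

definition slice_const :: real where
  "slice_const = 4 powr p * (2 * rate + 2 ^ Suc DIM('a) * (3 powr \<alpha> / V)) * enn2real energy"

lemma slice_const_nonneg: "slice_const \<ge> 0"
  using rate_nonneg V_pos unfolding slice_const_def by auto

lemma slice_distance:
  assumes "t > 0" "regular_slice t"
  shows "(\<integral>\<^sup>+ x. ennreal (\<bar>u (x, t) - v x\<bar> powr p) \<partial>lborel) \<le> ennreal (slice_const * (4 * t) powr (s * p - 1))"
proof -
  have "(\<integral>\<^sup>+ x. ennreal (\<bar>u (x, t) - v x\<bar> powr p) \<partial>lborel)
    \<le> ennreal (4 powr p * (2 * rate + 2 ^ Suc DIM('a) * (3 powr \<alpha> / V)) * (4 * t) powr (s * p - 1))
        * ennreal (enn2real energy)"
    using slice_distance_le[OF assms(1)] assms(2) energy_fin by (simp add: regular_slice_def ennreal_enn2real)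
  also have "\<dots> = ennreal (4 powr p * (2 * rate + 2 ^ Suc DIM('a) * (3 powr \<alpha> / V))
      * (4 * t) powr (s * p - 1) * enn2real energy)"
    by (rule ennreal_mult''[symmetric]) simp
  also have "4 powr p * (2 * rate + 2 ^ Suc DIM('a) * (3 powr \<alpha> / V)) * (4 * t) powr (s * p - 1)
      * enn2real energy = slice_const * (4 * t) powr (s * p - 1)"
    by (simp only: slice_const_def mult_ac)
  finally show ?thesis .
qed

text \<open>
  The choice \<open>\<delta> = (4t)\<^bsup>(sp - 1)/p\<^esup>\<close> makes the two terms of the comparison of \<open>L\<^sup>1\<close> with \<open>L\<^sup>p\<close> equal in
  order.
\<close>

lemma slice_distance_compact:
  assumes t: "t > 0" "regular_slice t" and K: "compact K"
  shows "(LINT x:K|lebesgue. \<bar>u (x, t) - v x\<bar>) \<le> (measure lborel K + slice_const) * (4 * t) powr ((s * p - 1) / p)"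
proof -
  define \<delta> where "\<delta> = (4 * t) powr ((s * p - 1) / p)"
  have \<delta>: "\<delta> > 0" using t by (simp add: \<delta>_def)
  have [measurable]: "K \<in> sets borel" using K by (simp add: borel_compact)
  have mK: "emeasure lborel K = ennreal (measure lborel K)"
    using compact_emeasure_fin[OF K] by (simp add: emeasure_eq_ennreal_measure less_top)
  have "(\<integral>\<^sup>+ x. indicator K x * ennreal \<bar>u (x, t) - v x\<bar> \<partial>lborel)
     \<le> ennreal \<delta> * emeasure lborel K + ennreal (\<delta> powr (1 - p))
         * (\<integral>\<^sup>+ x. ennreal (\<bar>u (x, t) - v x\<bar> powr p) \<partial>lborel)"
    using p_ge \<delta> by (intro integral_compact_le_powr) auto
  also have "\<dots> \<le> ennreal \<delta> * emeasure lborel K + ennreal (\<delta> powr (1 - p))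
      * ennreal (slice_const * (4 * t) powr (s * p - 1))"
    by (intro add_left_mono mult_left_mono slice_distance t) auto
  also have "\<dots> = ennreal (\<delta> * measure lborel K + \<delta> powr (1 - p) * (slice_const * (4 * t) powr (s * p - 1)))"
    using \<delta> slice_const_nonneg by (simp add: mK ennreal_mult')
  also have "\<delta> powr (1 - p) * (slice_const * (4 * t) powr (s * p - 1)) = slice_const * \<delta>"
  proof -
    have "(4 * t) powr (s * p - 1) = \<delta> powr p" using p_ge by (simp add: \<delta>_def powr_powr)
    then have "\<delta> powr (1 - p) * (4 * t) powr (s * p - 1) = \<delta>" using \<delta> by (simp add: powr_add[symmetric])
    then show ?thesis by (simp add: mult.left_commute)
  qed
  finally have le: "(\<integral>\<^sup>+ x. indicator K x * ennreal \<bar>u (x, t) - v x\<bar> \<partial>lborel)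
      \<le> ennreal ((measure lborel K + slice_const) * \<delta>)"
    by (simp add: algebra_simps)
  have "(LINT x:K|lebesgue. \<bar>u (x, t) - v x\<bar>) = (LINT x|lborel. indicator K x * \<bar>u (x, t) - v x\<bar>)"
    unfolding set_lebesgue_integral_def by (subst integral_completion) auto
  also have "\<dots> = enn2real (\<integral>\<^sup>+ x. ennreal (indicator K x * \<bar>u (x, t) - v x\<bar>) \<partial>lborel)"
    by (rule integral_eq_nn_integral) auto
  also have "\<dots> = enn2real (\<integral>\<^sup>+ x. indicator K x * ennreal \<bar>u (x, t) - v x\<bar> \<partial>lborel)"
    by (simp add: ennreal_mult' ennreal_indicator)
  also have "\<dots> \<le> (measure lborel K + slice_const) * \<delta>"
    using \<delta> slice_const_nonneg by (intro enn2real_leI le) (auto intro!: mult_nonneg_nonneg)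
  finally show ?thesis by (simp add: \<delta>_def)
qed

text \<open>
  The representative is \<open>u\<close> on the slices that are limits of their averages and equals \<open>v\<close> on every other
  slice; the latter make up a null set, and the distance to \<open>v\<close> is zero there.
\<close>

lemma slices_converge:
  obtains w where "AE y in lborel. y \<in> H \<longrightarrow> w y = u y"
    and "\<And>t. t > 0 \<Longrightarrow> locally_integrable (\<lambda>x. w (x, t))"
    and "\<And>K. compact K \<Longrightarrow> ((\<lambda>t. LINT x:K|lebesgue. \<bar>w (x, t) - v x\<bar>) \<longlongrightarrow> 0) (at_right 0)"
proof
  define w where "w y = (if regular_slice (snd y) then u y else v (fst y))" for y
  have "AE t in lborel. t > 0 \<longrightarrow> regular_slice t"
    using avg_tendsto_slice by (simp add: regular_slice_def)
  from AE_lborel_snd[OF this] show "AE y in lborel. y \<in> H \<longrightarrow> w y = u y"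
    by eventually_elim (auto simp: w_def)
  show "locally_integrable (\<lambda>x. w (x, t))" if t: "t > 0" for t
  proof (cases "regular_slice t")
    case True
    have "(\<integral>\<^sup>+ x. ennreal (\<bar>u (x, t) - v x\<bar> powr p) \<partial>lborel) < \<infinity>"
      using slice_distance[OF t True] by (rule le_less_trans) simp
    then have "locally_integrable (\<lambda>x. u (x, t))"
      by (intro locally_integrable_add_Lp[OF _ _ p_ge _ locally_integrable_v]) auto
    then show ?thesis using True by (simp add: w_def)
  next
    case False then show ?thesis using locally_integrable_v by (simp add: w_def)
  qed
  show "((\<lambda>t. LINT x:K|lebesgue. \<bar>w (x, t) - v x\<bar>) \<longlongrightarrow> 0) (at_right 0)" if K: "compact K" for K
  proof (rule tendsto_sandwich)
    let ?b = "\<lambda>t. (measure lborel K + slice_const) * (4 * t) powr ((s * p - 1) / p)"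
    show "eventually (\<lambda>t. 0 \<le> (LINT x:K|lebesgue. \<bar>w (x, t) - v x\<bar>)) (at_right 0)"
      by (auto simp: set_lebesgue_integral_def intro!: always_eventually integral_nonneg_AE)
    show "eventually (\<lambda>t. (LINT x:K|lebesgue. \<bar>w (x, t) - v x\<bar>) \<le> ?b t) (at_right 0)"
      unfolding eventually_at_right_field
    proof (intro exI[of _ 1] conjI allI impI)
      fix t :: real assume t: "0 < t" "t < 1"
      show "(LINT x:K|lebesgue. \<bar>w (x, t) - v x\<bar>) \<le> ?b t"
        using slice_distance_compact[OF t(1) _ K] slice_const_nonneg t
        by (cases "regular_slice t") (auto simp: w_def set_lebesgue_integral_def
            intro!: mult_nonneg_nonneg add_nonneg_nonneg)
    qed simp
    have "((\<lambda>t. (4 * t) powr ((s * p - 1) / p)) \<longlongrightarrow> (4 * 0) powr ((s * p - 1) / p)) (at_right 0)"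
      using sp p_ge by (intro tendsto_powr2 tendsto_intros)
        (auto simp: eventually_at_right_field intro!: exI[of _ 1])
    from tendsto_mult_left[OF this, of "measure lborel K + slice_const"]
    show "(?b \<longlongrightarrow> 0) (at_right 0)" by simp
  qed simp
qed

end

section \<open>The trace theorem on the half space\<close>

text \<open>
  A Lebesgue measurable \<open>u\<close> agrees almost everywhere on the half space with a Borel function. This changes
  neither the energy, nor the left-hand side, nor the trace, which only depends on \<open>u\<close> up to null sets.
\<close>

theorem theorem3p1:
  fixes s p :: real
  assumes "0 < s" and "s < 1" and "1 \<le> p" and "s * p > 1"
  shows "\<exists>C::real. C > 0 \<and>
    (\<forall>u \<in> hom_sobolev s p (half_space :: ((real ^ 'n) \<times> real) set).
      \<exists>v. has_trace u v \<and>
        (\<integral>\<^sup>+ x. (\<integral>\<^sup>+ y. ennreal (\<bar>v x - u y\<bar> powr p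
              / norm ((x, 0) - y) powr (real CARD('n) + s * p)) \<partial>lebesgue_on half_space) \<partial>lebesgue)
          \<le> ennreal C * gagliardo s p half_space u)"
proof -
  let ?V = "unit_ball_vol DIM(real ^ 'n)" and ?\<alpha> = "real DIM(real ^ 'n) + 1 + s * p"
    and ?e = "(s * p - 1) / 2"
  \<comment> \<open>The constant is chosen before \<open>u\<close>; it is the explicit value of \<open>main_const\<close>, made positive.\<close>
  define C where "C = 1 + \<bar>2 powr p * (tail_const DIM(real ^ 'n) ?\<alpha> * 5 powr ?\<alpha> / ?V
     + telescope_const ?e p * 2 ^ Suc DIM(real ^ 'n)
        * (tail_const (Suc DIM(real ^ 'n)) ?\<alpha> * 6 powr ?\<alpha> / ?V / (1 - 2 powr - ?e)))\<bar>"
  have "\<exists>v. has_trace u v \<and>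
        (\<integral>\<^sup>+ x. (\<integral>\<^sup>+ y. ennreal (\<bar>v x - u y\<bar> powr p
              / norm ((x, 0) - y) powr (real CARD('n) + s * p)) \<partial>lebesgue_on half_space) \<partial>lebesgue)
          \<le> ennreal C * gagliardo s p half_space u"
    if u: "u \<in> hom_sobolev s p (half_space :: ((real ^ 'n) \<times> real) set)" for u
  proof -
    have Hsets: "(half_space :: ((real ^ 'n) \<times> real) set) \<in> sets borel"
      unfolding half_space_def borel_prod[symmetric] by (intro pair_measureI) auto
    have HHsets: "(half_space \<times> half_space :: (((real ^ 'n) \<times> real) \<times> ((real ^ 'n) \<times> real)) set) \<in> sets borel"
      unfolding borel_prod[symmetric, where 'a = "(real ^ 'n) \<times> real" and 'b = "(real ^ 'n) \<times> real"]
      using Hsets by (intro pair_measureI) auto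
    have um: "u \<in> borel_measurable (lebesgue_on half_space)" and fin: "gagliardo s p half_space u < \<infinity>"
      using u by (auto simp: hom_sobolev_def)
    have "(\<lambda>y. indicator half_space y *\<^sub>R u y) \<in> borel_measurable lebesgue"
      using um Hsets by (subst (asm) borel_measurable_restrict_space_iff) auto
    then obtain f where f: "f \<in> borel_measurable borel" "AE y in lborel. indicator half_space y *\<^sub>R u y = f y"
      using completion_ex_borel_measurable_real[of "\<lambda>y. indicator half_space y *\<^sub>R u y" lborel] by auto
    have ae: "AE y in lborel. y \<in> half_space \<longrightarrow> f y = u y" using f(2) by eventually_elim auto
    have gf: "gagliardo s p half_space f = gagliardo s p half_space u"
    proof -
      have "AE c in lborel. fst c \<in> half_space \<longrightarrow> f (fst c) = u (fst c)"
        "AE c in lborel. snd c \<in> half_space \<longrightarrow> f (snd c) = u (snd c)"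
        by (rule AE_lborel_fst[OF ae], rule AE_lborel_snd[OF ae])
      then have "AE c in lborel. c \<in> half_space \<times> half_space \<longrightarrow> f (fst c) = u (fst c) \<and> f (snd c) = u (snd c)"
        by eventually_elim auto
      then have "AE c in lebesgue_on (half_space \<times> half_space). f (fst c) = u (fst c) \<and> f (snd c) = u (snd c)"
        using HHsets by (subst AE_restrict_space_iff) (auto dest: AE_completion)
      then show ?thesis unfolding gagliardo_def
        by (intro nn_integral_cong_AE, eventually_elim) (auto split: prod.splits)
    qed
    interpret sobolev_fun f s p ?V ?\<alpha> "\<lambda>r. ?V * r ^ Suc DIM(real ^ 'n)"
      by unfold_locales (use assms f(1) fin gf in \<open>auto simp: half_space_def\<close>)
    have "has_trace u v"
    proof -
      obtain w where w: "AE y in lborel. y \<in> UNIV \<times> {0<..} \<longrightarrow> w y = f y"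
        "\<And>t. t > 0 \<Longrightarrow> locally_integrable (\<lambda>x. w (x, t))"
        "\<And>K. compact K \<Longrightarrow> ((\<lambda>t. LINT x:K|lebesgue. \<bar>w (x, t) - v x\<bar>) \<longlongrightarrow> 0) (at_right 0)"
        by (rule slices_converge) blast
      have "AE y in lborel. y \<in> half_space \<longrightarrow> w y = u y"
        using w(1) ae by eventually_elim (auto simp: half_space_def)
      then have "AE y in lebesgue_on half_space. w y = u y"
        using Hsets by (subst AE_restrict_space_iff) (auto dest: AE_completion)
      then show ?thesis unfolding has_trace_def using w(2,3) locally_integrable_v by blast
    qed
    moreover have "(\<integral>\<^sup>+ x. (\<integral>\<^sup>+ y. ennreal (\<bar>v x - u y\<bar> powr p
              / norm ((x, 0) - y) powr (real CARD('n) + s * p)) \<partial>lebesgue_on half_space) \<partial>lebesgue)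
          \<le> ennreal C * gagliardo s p half_space u"
    proof -
      have \<beta>: "?\<alpha> - 1 = real CARD('n) + s * p" by simp
      have "(\<integral>\<^sup>+ x. (\<integral>\<^sup>+ y. ennreal (\<bar>v x - u y\<bar> powr p
              / norm ((x, 0) - y) powr (real CARD('n) + s * p)) \<partial>lebesgue_on half_space) \<partial>lebesgue)
          = (\<integral>\<^sup>+ x. \<integral>\<^sup>+ y. indicator half_space y
              * ennreal (\<bar>v x - f y\<bar> powr p / norm ((x, 0) - y) powr (?\<alpha> - 1)) \<partial>lborel \<partial>lborel)"
        unfolding nn_integral_completion
      proof (rule nn_integral_cong)
        fix x
        have "(\<integral>\<^sup>+ y. ennreal (\<bar>v x - u y\<bar> powr p / norm ((x, 0) - y) powr (real CARD('n) + s
            * p)) \<partial>lebesgue_on half_space)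
          = (\<integral>\<^sup>+ y. ennreal (\<bar>v x - u y\<bar> powr p / norm ((x, 0) - y) powr (real CARD('n) + s * p))
              * indicator half_space y \<partial>lborel)"
          using Hsets by (subst nn_integral_restrict_space) (auto simp: nn_integral_completion)
        also have "\<dots> = (\<integral>\<^sup>+ y. indicator half_space y
            * ennreal (\<bar>v x - f y\<bar> powr p / norm ((x, 0) - y) powr (?\<alpha> - 1)) \<partial>lborel)"
          using ae by (intro nn_integral_cong_AE, eventually_elim) (auto simp: indicator_def)
        finally show "(\<integral>\<^sup>+ y. ennreal (\<bar>v x - u y\<bar> powr p / norm ((x, 0) - y) powr (real CARD('n) + s
            * p)) \<partial>lebesgue_on half_space) = \<dots>" .
      qed
      also have "\<dots> \<le> ennreal main_const * energy"
        using trace_integral_le unfolding half_space_def .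
      also have "\<dots> \<le> ennreal C * energy"
        unfolding C_def main_const_def \<epsilon>_def by (intro mult_right_mono ennreal_leI) (linarith, simp)
      also have "energy = gagliardo s p half_space u"
        using gf by (simp add: energy_def half_space_def)
      finally show ?thesis .
    qed
    ultimately show ?thesis by blast
  qed
  moreover have "C > 0" by (simp add: C_def add_pos_nonneg)
  ultimately show ?thesis by blast
qed

end
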